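(* Fix an integer $M\ge1$ and let $C_n$ denote the number of key comparisons performed by Yaroslavskiy's dual-pivot Quicksort with Insertionsort threshold $M$ (described in the context) when sorting a uniformly random permutation of $\{1,\dots,n\}$. Then \[ \mathbb{E}[C_n]=\tfrac{19}{10}(n+1)\bigl(H_{n+1}-H_{M+2}\bigr)+\Bigl(\tfrac{124}{75}+\tfrac{3}{20}M-\tfrac{9}{5(M+2)}-\tfrac{12}{5(M+2)}H_{M+1}\Bigr)(n+1)+\tfrac32+O\bigl(n^{-4}\bigr) \] as $n\to\infty$, for $M\ge2$; and for $M=1$ and all $n\ge4$, \[ \mathbb{E}[C_n]=\tfrac{19}{10}(n+1)H_n-\tfrac{711}{200}n-\tfrac{31}{200}. \]
   Context: $H_n=\sum_{i=1}^n 1/i$ is the $n$th harmonic number. Yaroslavskiy's dual-pivot Quicksort with Insertionsort threshold $M\ge1$ is the procedure $\mathrm{QS}(A,\mathit{left},\mathit{right})$ sorting $A[\mathit{left}..\mathit{right}]$ (array of distinct keys), initially called as $\mathrm{QS}(A,1,n)$: (1) If $\mathit{right}-\mathit{left}<M$, run $\mathrm{InsertionSort}(A,\mathit{left},\mathit{right})$ and return. (2) Otherwise (a partitioning step): if $A[\mathit{left}]>A[\mathit{right}]$ set $p\gets A[\mathit{right}],q\gets A[\mathit{left}]$, else $p\gets A[\mathit{left}],q\gets A[\mathit{right}]$. Set $\ell\gets\mathit{left}+1$, $g\gets\mathit{right}-1$, $k\gets\ell$. (3) While $k\le g$: (i) if $A[k]<p$: swap $A[k],A[\ell]$ and $\ell\gets\ell+1$;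 (ii) else if $A[k]\ge q$: while ($A[g]>q$ and $k<g$) do $g\gets g-1$ (the comparison $A[g]>q$ is evaluated at every test of this condition); then if $A[g]\ge p$ swap $A[k],A[g]$, otherwise swap $A[k],A[g]$, then swap $A[k],A[\ell]$ and set $\ell\gets\ell+1$; finally $g\gets g-1$; (iii) $k\gets k+1$. (4) $\ell\gets\ell-1$, $g\gets g+1$; $A[\mathit{left}]\gets A[\ell]$, $A[\ell]\gets p$; $A[\mathit{right}]\gets A[g]$, $A[g]\gets q$. (5) Call $\mathrm{QS}(A,\mathit{left},\ell-1)$, $\mathrm{QS}(A,\ell+1,g-1)$, $\mathrm{QS}(A,g+1,\mathit{right})$. $\mathrm{InsertionSort}(A,\mathit{left},\mathit{right})$: for $i=\mathit{left}+1,\dots,\mathit{right}$: $j\gets i-1$, $v\gets A[i]$; while $j\ge\mathit{left}$ and $v<A[j]$ (the comparison $v<A[j]$ being evaluated only when $j\ge\mathit{left}$): $A[j+1]\gets A[j]$, $j\gets j-1$; then $A[j+1]\gets v$. Key comparisons counted: $A[\mathit{left}]>A[\mathit{right}]$ (once per partitioning step) and every evaluation of $A[k]<p$, $A[k]\ge q$, $A[g]>q$, $A[g]\ge p$, and $v<A[j]$. *)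

theory Defs
  imports "HOL-Probability.Probability" "HOL-Combinatorics.Permutations"
    "HOL-Library.Landau_Symbols"
begin

text \<open>
  Arrays are functions on integer indices. Integers rather than naturals, so that empty ranges
  such as \<open>A[left..left - 1]\<close> and the test \<open>right - left < M\<close> are not distorted by truncated
  subtraction. The last component of every result is the number of key comparisons made;
  loops carry it as an accumulator \<open>c\<close>.
\<close>

definition swap_at :: "(int \<Rightarrow> 'a) \<Rightarrow> int \<Rightarrow> int \<Rightarrow> int \<Rightarrow> 'a" where
  "swap_at A i j = A(i := A j, j := A i)"

text \<open>The inner loop of insertion sort, together with the final assignment of \<open>v\<close>.\<close>

function insert_loop ::
  "(int \<Rightarrow> 'a::linorder) \<Rightarrow> 'a \<Rightarrow> int \<Rightarrow> int \<Rightarrow> nat \<Rightarrow> (int \<Rightarrow> 'a) \<times> nat" where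
  "insert_loop A v left j c =
    (if j \<ge> left then
       if v < A j then insert_loop (A(j + 1 := A j)) v left (j - 1) (c + 1)
       else (A(j + 1 := v), c + 1)
     else (A(j + 1 := v), c))"
  by pat_completeness auto
termination
  by (relation "Wellfounded.measure (\<lambda>(A, v, left, j, c). nat (j + 1 - left))") auto

declare insert_loop.simps [simp del]

definition insertion_sort ::
  "(int \<Rightarrow> 'a::linorder) \<Rightarrow> int \<Rightarrow> int \<Rightarrow> (int \<Rightarrow> 'a) \<times> nat" where
  "insertion_sort A left right =
    fold (\<lambda>i (A, c). insert_loop A (A i) left (i - 1) c) [left + 1..right] (A, 0)"

text \<open>
  The loop decrementing \<open>g\<close>. The comparison \<open>A g > q\<close> comes first in the loop condition and
  is therefore charged at every test, including the one that ends the loop.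
\<close>

function scan_down ::
  "(int \<Rightarrow> 'a::linorder) \<Rightarrow> 'a \<Rightarrow> int \<Rightarrow> int \<Rightarrow> nat \<Rightarrow> int \<times> nat" where
  "scan_down A q k g c =
    (if A g > q \<and> k < g then scan_down A q k (g - 1) (c + 1) else (g, c + 1))"
  by pat_completeness auto
termination
  by (relation "Wellfounded.measure (\<lambda>(A, q, k, g, c). nat (g - k))") auto

declare scan_down.simps [simp del]

lemma scan_down_bounds:
  assumes "scan_down A q k g c = (g', c')"
  shows "g' \<le> g" and "k \<le> g \<Longrightarrow> k \<le> g'"
proof -
  have "g' \<le> g \<and> (k \<le> g \<longrightarrow> k \<le> g')"
    using assms
  proof (induction A q k g c rule: scan_down.induct)
    case (1 A q k g c)
    show ?case
    proof (cases "A g > q \<and> k < g")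
      case True
      with "1.prems" have "scan_down A q k (g - 1) (c + 1) = (g', c')"
        by (subst (asm) scan_down.simps) simp
      from "1.IH"[OF True this] True show ?thesis by auto
    next
      case False
      with "1.prems" have "g' = g"
        by (subst (asm) scan_down.simps) auto
      then show ?thesis by simp
    qed
  qed
  then show "g' \<le> g" and "k \<le> g \<Longrightarrow> k \<le> g'" by auto
qed

function partition_loop ::
  "(int \<Rightarrow> 'a::linorder) \<Rightarrow> 'a \<Rightarrow> 'a \<Rightarrow> int \<Rightarrow> int \<Rightarrow> int \<Rightarrow> nat \<Rightarrow>
    (int \<Rightarrow> 'a) \<times> int \<times> int \<times> nat" where
  "partition_loop A p q l k g c =
    (if k \<le> g then
       if A k < p then partition_loop (swap_at A k l) p q (l + 1) (k + 1) g (c + 1)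
       else if A k \<ge> q then
         (case scan_down A q k g (c + 2) of (g', c') \<Rightarrow>
            if A g' \<ge> p
            then partition_loop (swap_at A k g') p q l (k + 1) (g' - 1) (c' + 1)
            else partition_loop (swap_at (swap_at A k g') k l) p q (l + 1) (k + 1)
                   (g' - 1) (c' + 1))
       else partition_loop A p q l (k + 1) g (c + 2)
     else (A, l, g, c))"
  by pat_completeness auto
termination
  by (relation "Wellfounded.measure (\<lambda>(A, p, q, l, k, g, c). nat (g + 1 - k))")
    (auto dest: scan_down_bounds(1)[OF sym])

declare partition_loop.simps [simp del]

text \<open>
  A partitioning step; the result is the array, the final positions of the two pivots, and the
  number of comparisons, the initial count 1 being the comparison of \<open>A left\<close> with \<open>A right\<close>.
\<close>

definition partition_step ::
  "(int \<Rightarrow> 'a::linorder) \<Rightarrow> int \<Rightarrow> int \<Rightarrow> (int \<Rightarrow> 'a) \<times> int \<times> int \<times> nat" where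
  "partition_step A left right =
    (let (p, q) = (if A left > A right then (A right, A left) else (A left, A right));
         (A1, l1, g1, c) = partition_loop A p q (left + 1) (left + 1) (right - 1) 1;
         l = l1 - 1;
         g = g1 + 1;
         A2 = A1(left := A1 l, l := p);
         A3 = A2(right := A2 g, g := q)
     in (A3, l, g, c))"

lemma partition_loop_bounds:
  assumes "partition_loop A p q l k g c = (A', l', g', c')"
    and "left < l" "l \<le> k" "k \<le> g + 2" "k \<le> right + 1" "g < right" "left \<le> g + 1"
    and "k \<le> g \<Longrightarrow> k \<le> right"
  shows "left < l' \<and> l' \<le> right + 1 \<and> left \<le> g' + 1 \<and> g' < right"
  using assms
proof (induction A p q l k g c rule: partition_loop.induct)
  case (1 A p q l k g c)
  show ?case
  proof (cases "k \<le> g")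
    case False
    with "1.prems" show ?thesis
      by (subst (asm) partition_loop.simps) auto
  next
    case kg: True
    show ?thesis
    proof (cases "A k < p")
      case True
      with "1.prems"(1) kg have
        "partition_loop (swap_at A k l) p q (l + 1) (k + 1) g (c + 1) = (A', l', g', c')"
        by (subst (asm) partition_loop.simps) simp
      then show ?thesis
        by (rule "1.IH"(1)[OF kg True]) (use "1.prems" kg in auto)
    next
      case nlt: False
      show ?thesis
      proof (cases "A k \<ge> q")
        case False
        with "1.prems"(1) kg nlt have
          "partition_loop A p q l (k + 1) g (c + 2) = (A', l', g', c')"
          by (subst (asm) partition_loop.simps) simp
        then show ?thesis
          by (rule "1.IH"(4)[OF kg nlt False]) (use "1.prems" kg in auto)
      next
        case ge: True
        obtain h d where hd: "scan_down A q k g (c + 2) = (h, d)" by force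
        have h: "h \<le> g" "k \<le> h" using scan_down_bounds[OF hd] kg by auto
        show ?thesis
        proof (cases "A h \<ge> p")
          case True
          with "1.prems"(1) kg nlt ge hd have
            "partition_loop (swap_at A k h) p q l (k + 1) (h - 1) (d + 1) = (A', l', g', c')"
            by (subst (asm) partition_loop.simps) simp
          then show ?thesis
            by (rule "1.IH"(2)[OF kg nlt ge hd[symmetric] True])
              (use "1.prems" kg h in auto)
        next
          case False
          with "1.prems"(1) kg nlt ge hd have
            "partition_loop (swap_at (swap_at A k h) k l) p q (l + 1) (k + 1) (h - 1) (d + 1)
              = (A', l', g', c')"
            by (subst (asm) partition_loop.simps) simp
          then show ?thesis
            by (rule "1.IH"(3)[OF kg nlt ge hd[symmetric] False])
              (use "1.prems" kg h in auto)
        qed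
      qed
    qed
  qed
qed

lemma partition_step_bounds:
  assumes "partition_step A left right = (A', l, g, c)" and "left \<le> right"
  shows "left \<le> l" "l \<le> right" "left \<le> g" "g \<le> right"
proof -
  define p where "p = (if A left > A right then A right else A left)"
  define q where "q = (if A left > A right then A left else A right)"
  obtain A1 l1 g1 c1 where
    *: "partition_loop A p q (left + 1) (left + 1) (right - 1) 1 = (A1, l1, g1, c1)"
    by (metis prod_cases4)
  have "left < l1 \<and> l1 \<le> right + 1 \<and> left \<le> g1 + 1 \<and> g1 < right"
    by (rule partition_loop_bounds[OF *]) (use assms(2) in auto)
  moreover have "l = l1 - 1" "g = g1 + 1"
    using assms(1) * by (auto simp: partition_step_def Let_def p_def q_def split: if_splits)
  ultimately show "left \<le> l" "l \<le> right" "left \<le> g" "g \<le> right" by auto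
qed

text \<open>Dual-pivot Quicksort with Insertionsort threshold \<open>M\<close>.\<close>

function quicksort ::
  "nat \<Rightarrow> (int \<Rightarrow> 'a::linorder) \<Rightarrow> int \<Rightarrow> int \<Rightarrow> (int \<Rightarrow> 'a) \<times> nat" where
  "quicksort M A left right =
    (if right - left < int M then insertion_sort A left right
     else
       (case partition_step A left right of (A0, l, g, c0) \<Rightarrow>
        case quicksort M A0 left (l - 1) of (A1, c1) \<Rightarrow>
        case quicksort M A1 (l + 1) (g - 1) of (A2, c2) \<Rightarrow>
        case quicksort M A2 (g + 1) right of (A3, c3) \<Rightarrow>
          (A3, c0 + c1 + c2 + c3)))"
  by pat_completeness auto
termination
proof (relation "Wellfounded.measure (\<lambda>(M, A, left, right). nat (right + 1 - left))", goal_cases)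
  case 1
  show ?case by simp
next
  case (2 M A left right A0 y l z g c0)
  then show ?case using partition_step_bounds[of A left right A0 l g c0] by auto
next
  case (3 M A left right A0 y l z g c0)
  then show ?case using partition_step_bounds[of A left right A0 l g c0] by auto
next
  case (4 M A left right A0 y l z g c0)
  then show ?case using partition_step_bounds[of A left right A0 l g c0] by auto
qed

declare quicksort.simps [simp del]

definition key_comparisons :: "nat \<Rightarrow> nat \<Rightarrow> (int \<Rightarrow> 'a::linorder) \<Rightarrow> nat" where
  "key_comparisons M n A = snd (quicksort M A 1 (int n))"

text \<open>
  A permutation of \<open>{1..n}\<close>, being a function on the integers, is itself the input array.
\<close>

definition expected_comparisons :: "nat \<Rightarrow> nat \<Rightarrow> real" where
  "expected_comparisons M n =
    measure_pmf.expectation (pmf_of_set {\<pi>. \<pi> permutes {1..int n}})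
      (\<lambda>\<pi>. real (key_comparisons M n \<pi>))"

end

theory Submission
  imports Defs
begin

text \<open>
  During partitioning, comparisons only test whether an element is small (less than \<open>p\<close>), large
  (greater than \<open>q\<close>) or in between. Hence permuting the values inside one of the three classes
  permutes the result in the same way and leaves the count unchanged, and averaging over such
  relabellings shows that the three subarrays are uniformly distributed given the pivots. The
  number \<open>n - q\<close> of large elements determines which positions are inspected by \<open>k\<close> and which by
  \<open>g\<close>, so exchangeability of the positions gives the expected cost \<open>19/12 * (n + 1) - 3\<close> of a
  partitioning step. Second differences turn the resulting recurrence into a linear one of order two
  whose homogeneous solutions are \<open>n + 1\<close> and \<open>1 / (n * (n - 1) * (n - 2) * (n - 3))\<close>. The
  claimed main term is a particular solution, and comparing the first two values above the
  threshold shows that the difference has no \<open>n + 1\<close> component.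
\<close>

subsection \<open>Partitioning\<close>

text \<open>The loop rewrites the array while reading it, so its count must be expressed through the
  initial array before it can be averaged; \<open>partition_cost\<close> does this.

  The cost \<open>19/12 * (n + 1) - 3\<close> is wrong for \<open>n = 2\<close>, where it gives 7/4
  while a single comparison is made. For \<open>M >= 2\<close> such ranges go to insertion sort, and
  the recurrence holds from the first size above the threshold. For \<open>M = 1\<close> size two is
  partitioned, its value enters separately, and the coefficient of \<open>n + 1\<close> comes out
  differently. This is why there are two claims.

  In the main term, \<open>19/10\<close> and \<open>3/2\<close> are forced by the inhomogeneous part
  of the difference equation, the coefficient of \<open>n + 1\<close> by the first two values above
  the threshold. What is left is a multiple of the decaying solution, hence the error term. For
  \<open>M = 1\<close> the first-order relation starts at \<open>n = 3\<close>, where its factor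
  \<open>n - 3\<close> is zero; it forces the difference to vanish from \<open>n = 4\<close> on, so
  the formula is exact there.\<close>

lemma swap_at_conv_transpose: "swap_at A i j = A \<circ> Transposition.transpose i j"
  by (auto simp: swap_at_def fun_eq_iff Transposition.transpose_def)

lemma scan_down_spec:
  assumes "scan_down A q k g c = (g', c')" "k \<le> g"
  shows "k \<le> g' \<and> g' \<le> g \<and> (\<forall>i\<in>{g'<..g}. q < A i) \<and> (k < g' \<longrightarrow> A g' \<le> q)
    \<and> c' = c + nat (g - g') + 1"
  using assms
proof (induction A q k g c rule: scan_down.induct)
  case (1 A q k g c)
  show ?case
  proof (cases "A g > q \<and> k < g")
    case True
    with "1.prems" have "scan_down A q k (g - 1) (c + 1) = (g', c')"
      by (subst (asm) scan_down.simps) simp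
    from "1.IH"[OF True this] True have IH: "k \<le> g' \<and> g' \<le> g - 1 \<and> (\<forall>i\<in>{g'<..g - 1}. q < A i) \<and>
        (k < g' \<longrightarrow> A g' \<le> q) \<and> c' = c + 1 + nat (g - 1 - g') + 1"
      by auto
    moreover have "q < A i" if "i \<in> {g'<..g}" for i
      using that IH True by (cases "i = g") auto
    moreover have "nat (g - g') = nat (g - 1 - g') + 1" using IH by auto
    ultimately show ?thesis by auto
  next
    case False
    with "1.prems" have "g' = g" "c' = c + 1"
      by (subst (asm) scan_down.simps; auto)+
    then show ?thesis using False "1.prems" by auto
  qed
qed

text \<open>Invariant rule with one case per branch of the loop body. A large \<open>A k\<close>
  costs two comparisons at \<open>k\<close>, \<open>g - h + 1\<close> tests in the scan and one test
  of \<open>A h\<close> against \<open>p\<close>, hence \<open>nat (g - h) + 4\<close>. The final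
  \<open>k'\<close> is existential because the loop does not return it.\<close>

lemma partition_loop_rule [consumes 2, case_names small medium large_ge large_less]:
  assumes "partition_loop A p q l k g c = (A', l', g', c')" and "I A l k g c"
    and "\<And>A l k g c. I A l k g c \<Longrightarrow> k \<le> g \<Longrightarrow> A k < p \<Longrightarrow>
      I (swap_at A k l) (l + 1) (k + 1) g (c + 1)"
    and "\<And>A l k g c. I A l k g c \<Longrightarrow> k \<le> g \<Longrightarrow> p \<le> A k \<Longrightarrow> A k < q \<Longrightarrow> I A l (k + 1) g (c + 2)"
    and "\<And>A l k g c h. I A l k g c \<Longrightarrow> p \<le> A k \<Longrightarrow> q \<le> A k \<Longrightarrow> k \<le> h \<Longrightarrow> h \<le> g \<Longrightarrow>
      \<forall>i\<in>{h<..g}. q < A i \<Longrightarrow> (k < h \<Longrightarrow> A h \<le> q) \<Longrightarrow> p \<le> A h \<Longrightarrow>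
      I (swap_at A k h) l (k + 1) (h - 1) (c + nat (g - h) + 4)"
    and "\<And>A l k g c h. I A l k g c \<Longrightarrow> p \<le> A k \<Longrightarrow> q \<le> A k \<Longrightarrow> k \<le> h \<Longrightarrow> h \<le> g \<Longrightarrow>
      \<forall>i\<in>{h<..g}. q < A i \<Longrightarrow> (k < h \<Longrightarrow> A h \<le> q) \<Longrightarrow> A h < p \<Longrightarrow>
      I (swap_at (swap_at A k h) k l) (l + 1) (k + 1) (h - 1) (c + nat (g - h) + 4)"
  shows "\<exists>k'>g'. I A' l' k' g' c'"
  using assms(1,2)
proof (induction "nat (g + 1 - k)" arbitrary: A l k g c rule: less_induct)
  case less
  note run = less.prems(1) and inv = less.prems(2)
  show ?case
  proof (cases "k \<le> g")
    case False
    with run inv show ?thesis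
      by (subst (asm) partition_loop.simps) (auto intro!: exI[of _ k])
  next
    case kg: True
    consider "A k < p" | "p \<le> A k" "A k < q" | "p \<le> A k" "q \<le> A k" by force
    then show ?thesis
    proof cases
      case 1
      with run kg have "partition_loop (swap_at A k l) p q (l + 1) (k + 1) g (c + 1) = (A', l', g', c')"
        by (subst (asm) partition_loop.simps) simp
      from less.hyps[OF _ this assms(3)[OF inv kg 1]] kg show ?thesis by simp
    next
      case 2
      then have "\<not> A k < p" "\<not> q \<le> A k" by auto
      with run kg have "partition_loop A p q l (k + 1) g (c + 2) = (A', l', g', c')"
        by (subst (asm) partition_loop.simps) simp
      from less.hyps[OF _ this assms(4)[OF inv kg 2]] kg show ?thesis by simp
    next
      case 3
      then have not_less: "\<not> A k < p" by auto
      obtain h d where hd: "scan_down A q k g (c + 2) = (h, d)" by force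
      note spec = scan_down_spec[OF hd kg]
      then have d: "d + 1 = c + nat (g - h) + 4" by simp
      show ?thesis
      proof (cases "p \<le> A h")
        case True
        with run kg 3 not_less hd d have "partition_loop (swap_at A k h) p q l (k + 1) (h - 1)
            (c + nat (g - h) + 4) = (A', l', g', c')"
          by (subst (asm) partition_loop.simps) (simp add: add_ac)
        from less.hyps[OF _ this assms(5)[OF inv 3]] spec kg True show ?thesis by simp
      next
        case False
        with run kg 3 not_less hd d have "partition_loop (swap_at (swap_at A k h) k l) p q (l + 1) (k + 1)
            (h - 1) (c + nat (g - h) + 4) = (A', l', g', c')"
          by (subst (asm) partition_loop.simps) (simp add: add_ac)
        from less.hyps[OF _ this assms(6)[OF inv 3]] spec kg False show ?thesis by simp
      qed
    qed
  qed
qed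

text \<open>
  \<open>\<beta>\<close> is the position at which \<open>k\<close> and \<open>g\<close> meet: positions up to \<open>\<beta>\<close> are first inspected by \<open>k\<close>,
  later ones by \<open>g\<close>. If the element at \<open>\<beta> + 1\<close> is large, it is inspected by both, at a cost of
  four comparisons instead of one.
\<close>

definition partition_cost :: "(int \<Rightarrow> 'a::linorder) \<Rightarrow> 'a \<Rightarrow> 'a \<Rightarrow> int \<Rightarrow> int \<Rightarrow> int \<Rightarrow> nat" where
  "partition_cost A p q \<beta> k g =
    (\<Sum>i\<in>{k..g}. 1 + (if i \<le> \<beta> then of_bool (p \<le> A i) else of_bool (A i \<le> q))) +
    3 * of_bool (k \<le> \<beta> + 1 \<and> \<beta> + 1 \<le> g \<and> q < A (\<beta> + 1))"

lemma partition_cost_cong: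
  assumes "\<And>i. i \<in> {k..g} \<Longrightarrow> A i = B i"
  shows "partition_cost A p q \<beta> k g = partition_cost B p q \<beta> k g"
  unfolding partition_cost_def
  by (intro arg_cong2[of _ _ _ _ "(+)"] sum.cong refl)
     (use assms in \<open>auto simp: of_bool_def\<close>)

lemma partition_cost_step:
  assumes "k \<le> g" "k \<le> \<beta>"
  shows "partition_cost A p q \<beta> k g = 1 + of_bool (p \<le> A k) + partition_cost A p q \<beta> (k + 1) g"
proof -
  have "{k..g} = insert k {k+1..g}" using assms(1) by auto
  then show ?thesis using assms(2) by (simp add: partition_cost_def)
qed

text \<open>A large branch with \<open>k < h\<close> pays two comparisons for \<open>A k\<close>,
  one for each element scanned over, and two for \<open>A h\<close>: the test that stops the scan
  and the one against \<open>p\<close>.\<close>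

lemma partition_cost_large:
  assumes "k < h" "h \<le> g" "\<forall>i\<in>{h<..g}. q < A i" "A h \<le> q" "p \<le> A k" "k \<le> \<beta>" "\<beta> < h"
  shows "partition_cost A p q \<beta> k g = partition_cost A p q \<beta> (k + 1) (h - 1) + nat (g - h) + 4"
proof -
  let ?f = "\<lambda>i. 1 + (if i \<le> \<beta> then of_bool (p \<le> A i) else of_bool (A i \<le> q)) :: nat"
  have split: "{k..g} = insert k (insert h ({k+1..h-1} \<union> {h<..g}))" using assms(1,2) by auto
  have "sum ?f {k..g} = ?f k + (?f h + (sum ?f {k+1..h-1} + sum ?f {h<..g}))"
    unfolding split by (subst sum.insert sum.union_disjoint; use assms(1) in auto)+
  moreover have "sum ?f {h<..g} = (\<Sum>i\<in>{h<..g}. 1)"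
    by (intro sum.cong) (use assms in \<open>auto dest: leD\<close>)
  \<comment> \<open>The surcharge is not lost when the range shrinks: \<open>\<beta> + 1\<close>
    lies beyond \<open>h - 1\<close> only if it equals \<open>h\<close>, and \<open>A h\<close> is
    not large.\<close>
  moreover have "\<not> (\<beta> + 1 > h - 1 \<and> q < A (\<beta> + 1))" "\<not> \<beta> + 1 > g"
    using assms by (cases "\<beta> + 1 = h"; auto)+
  ultimately show ?thesis using assms by (auto simp: partition_cost_def)
qed

text \<open>The scan runs down to \<open>k\<close> itself and stops only because
  \<open>k < g\<close> fails. So \<open>A k\<close> is charged two comparisons by \<open>k\<close>,
  one by the scan and one against \<open>p\<close>, each other element one.\<close>

lemma partition_cost_meet:
  assumes "k \<le> g" "\<forall>i\<in>{k..g}. q < A i"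
  shows "partition_cost A p q (k - 1) k g = nat (g - k) + 4"
proof -
  have "(\<Sum>i\<in>{k..g}. 1 + (if i \<le> k - 1 then of_bool (p \<le> A i) else of_bool (A i \<le> q)))
    = (\<Sum>i\<in>{k..g}. 1::nat)"
    by (intro sum.cong) (use assms in \<open>auto dest: leD\<close>)
  then show ?thesis using assms by (auto simp: partition_cost_def)
qed

text \<open>Invariant: the number of large elements in the unread range \<open>{k..g}\<close> is
  \<open>g - \<beta>\<close>, and the cost paid plus the cost of the unread range is constant. A
  large branch removes as many large elements as it lowers \<open>g\<close>; the other branches
  remove none. Swaps reach only the ends of the unread range or positions already read, so the rest
  still holds its original content.\<close>

lemma partition_loop_cost:
  assumes "partition_loop A p q l l g c = (A', l', g', c')" "q \<notin> A ` {l..g}" "p < q"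
    and "\<beta> = g - int (card {i\<in>{l..g}. q < A i})"
  shows "c' = c + partition_cost A p q \<beta> l g"
proof -
  define I where "I = (\<lambda>A1 l1 k1 g1 c1. l1 \<le> k1 \<and> q \<notin> A1 ` {k1..g1} \<and>
    int (card {i\<in>{k1..g1}. q < A1 i}) + \<beta> = g1 \<and>
    c1 + partition_cost A1 p q \<beta> k1 g1 = c + partition_cost A p q \<beta> l g)"
  have I: "I A l l g c" using assms by (auto simp: I_def)
  \<comment> \<open>One element that is not large leaves at most \<open>g1 - k1\<close> large ones
    in the unread range.\<close>
  have le_beta: "k1 \<le> \<beta>" if "I A1 l1 k1 g1 c1" "k1 \<le> h" "h \<le> g1" "\<not> q < A1 h" for A1 l1 k1 g1 c1 h
  proof -
    have "card {i\<in>{k1..g1}. q < A1 i} \<le> card ({k1..g1} - {h})"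
      using that by (intro card_mono) auto
    then show ?thesis using that by (auto simp: I_def)
  qed
  \<comment> \<open>The element at \<open>k1\<close> and those scanned over already make
    \<open>g1 - h + 1\<close> large ones.\<close>
  have beta_less: "\<beta> < h" if "I A1 l1 k1 g1 c1" "k1 < h" "h \<le> g1" "\<forall>i\<in>{h<..g1}. q < A1 i" "q < A1 k1"
    for A1 l1 k1 g1 c1 h
  proof -
    have "card (insert k1 {h<..g1}) \<le> card {i\<in>{k1..g1}. q < A1 i}"
      using that by (intro card_mono[OF finite_subset[of _ "{k1..g1}"]]) auto
    then show ?thesis using that by (auto simp: I_def)
  qed
  \<comment> \<open>Covers both large branches: they differ in \<open>l2\<close> and in the swaps,
    but agree strictly between \<open>k1\<close> and \<open>h\<close>.\<close>
  have large: "I A2 l2 (k1 + 1) (h - 1) (c1 + nat (g1 - h) + 4)"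
    if I: "I A1 l1 k1 g1 c1" and A: "p \<le> A1 k1" "q \<le> A1 k1" and kh: "k1 \<le> h" "h \<le> g1"
      and scanned: "\<forall>i\<in>{h<..g1}. q < A1 i" and "k1 < h \<Longrightarrow> A1 h \<le> q"
      and l2: "l2 \<le> k1 + 1"
      and eq: "\<And>i. i \<in> {k1 + 1..h - 1} \<Longrightarrow> A2 i = A1 i"
    for A1 A2 l1 l2 k1 g1 c1 h
  proof -
    have "q \<notin> A1 ` {k1..g1}" using I by (auto simp: I_def)
    moreover have "k1 \<in> {k1..g1}" using kh by auto
    ultimately have qk: "q < A1 k1" using A(2) by (metis image_eqI order_le_less)
    have cong: "partition_cost A2 p q \<beta> (k1 + 1) (h - 1) = partition_cost A1 p q \<beta> (k1 + 1) (h - 1)"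
      by (rule partition_cost_cong) (use eq in auto)
    have q2: "q \<notin> A2 ` {k1 + 1..h - 1}" using I kh eq by (fastforce simp: I_def)
    show ?thesis
    proof (cases "k1 < h")
      case True
      then have h: "A1 h \<le> q" using that by auto
      have b: "k1 \<le> \<beta>" "\<beta> < h" using le_beta[OF I, of h] beta_less[OF I True] kh h scanned qk by auto
      have sets: "{i\<in>{k1..g1}. q < A1 i} = insert k1 ({i\<in>{k1 + 1..h - 1}. q < A2 i} \<union> {h<..g1})"
        (is "?L = insert k1 (?S \<union> _)")
      proof (rule set_eqI)
        fix i
        consider "i < k1" | "i = k1" | "i \<in> {k1 + 1..h - 1}" | "i = h" | "i \<in> {h<..g1}" | "g1 < i"
          by force
        then show "i \<in> ?L \<longleftrightarrow> i \<in> insert k1 (?S \<union> {h<..g1})"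
          by cases (use eq True kh h scanned qk in auto)
      qed
      have fin: "finite ?S" by (rule finite_subset[of _ "{k1..h}"]) auto
      from sets have "card ?L = card (insert k1 (?S \<union> {h<..g1}))" by simp
      also have "\<dots> = Suc (card (?S \<union> {h<..g1}))"
        by (rule card_insert_disjoint) (use True fin in auto)
      also have "card (?S \<union> {h<..g1}) = card ?S + card {h<..g1}"
        by (rule card_Un_disjoint) (use fin in auto)
      finally have "int (card ?L) = int (card ?S) + 1 + (g1 - h)" using kh by auto
      moreover have "int (card ?L) + \<beta> = g1" using I by (auto simp: I_def)
      ultimately have "int (card ?S) + \<beta> = h - 1" by simp
      with partition_cost_large[OF True kh(2) scanned h A(1) b] I l2 q2 cong show ?thesis
        by (auto simp: I_def)
    next
      case False
      then have h: "h = k1" using kh by auto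
      have all: "\<forall>i\<in>{k1..g1}. q < A1 i"
      proof
        fix i assume "i \<in> {k1..g1}"
        then show "q < A1 i" using scanned qk h by (cases "i = k1") auto
      qed
      then have "{i\<in>{k1..g1}. q < A1 i} = {k1..g1}" by auto
      with I kh have b: "\<beta> = k1 - 1" by (auto simp: I_def)
      have z: "partition_cost A2 p q \<beta> (k1 + 1) (h - 1) = 0" using h by (simp add: partition_cost_def b)
      have "{i\<in>{k1 + 1..h - 1}. q < A2 i} = {}" using h by auto
      then have card0: "card {i\<in>{k1 + 1..h - 1}. q < A2 i} = 0" by (simp only: card.empty)
      have "c1 + partition_cost A1 p q \<beta> k1 g1 = c + partition_cost A p q \<beta> l g" using I by (simp add: I_def)
      then have "c1 + nat (g1 - h) + 4 + 0 = c + partition_cost A p q \<beta> l g"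
        using partition_cost_meet[OF _ all, of p] kh h b by simp
      then show ?thesis unfolding I_def z card0 using l2 q2 b h by simp
    qed
  qed
  have "\<exists>k'>g'. I A' l' k' g' c'"
    using assms(1) I
  proof (induction rule: partition_loop_rule)
    case (small A1 l1 k1 g1 c1)
    have "{i\<in>{k1..g1}. q < A1 i} = {i\<in>{k1+1..g1}. q < swap_at A1 k1 l1 i}"
    proof (rule set_eqI)
      fix i
      show "i \<in> {i\<in>{k1..g1}. q < A1 i} \<longleftrightarrow> i \<in> {i\<in>{k1+1..g1}. q < swap_at A1 k1 l1 i}"
        using small assms(3) by (cases "i = k1") (auto simp: I_def swap_at_def)
    qed
    moreover have "partition_cost A1 p q \<beta> k1 g1 = 1 + partition_cost A1 p q \<beta> (k1 + 1) g1"
      using partition_cost_step[of k1 g1 \<beta> A1 p q] small le_beta[OF small(1), of k1] assms(3) by auto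
    moreover have "partition_cost (swap_at A1 k1 l1) p q \<beta> (k1 + 1) g1 = partition_cost A1 p q \<beta> (k1 + 1) g1"
      using small by (intro partition_cost_cong) (auto simp: swap_at_def I_def)
    moreover have "q \<notin> swap_at A1 k1 l1 ` {k1+1..g1}"
      using small by (fastforce simp: I_def swap_at_def)
    ultimately show ?case using small by (auto simp: I_def)
  next
    case (medium A1 l1 k1 g1 c1)
    have "{i\<in>{k1..g1}. q < A1 i} = {i\<in>{k1+1..g1}. q < A1 i}"
    proof (rule set_eqI)
      fix i
      show "i \<in> {i\<in>{k1..g1}. q < A1 i} \<longleftrightarrow> i \<in> {i\<in>{k1+1..g1}. q < A1 i}"
        using medium by (cases "i = k1") auto
    qed
    moreover have "partition_cost A1 p q \<beta> k1 g1 = 2 + partition_cost A1 p q \<beta> (k1 + 1) g1"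
      using partition_cost_step[of k1 g1 \<beta> A1 p q] medium le_beta[OF medium(1), of k1] assms(3) by auto
    ultimately show ?case using medium by (auto simp: I_def)
  next
    case (large_ge A1 l1 k1 g1 c1 h)
    show ?case
      by (rule large[OF large_ge(1-7)]) (use large_ge in \<open>auto simp: I_def swap_at_def\<close>)
  next
    case (large_less A1 l1 k1 g1 c1 h)
    show ?case
      by (rule large[OF large_less(1-7)]) (use large_less in \<open>auto simp: I_def swap_at_def\<close>)
  qed
  then obtain k' where k': "g' < k'" "I A' l' k' g' c'" by auto
  then have "partition_cost A' p q \<beta> k' g' = 0" by (auto simp: partition_cost_def)
  with k' show ?thesis by (simp add: I_def)
qed

section \<open>Effect of partitioning on the array\<close>

lemma swap_at_permutes:
  assumes "\<sigma> permutes S" "B = A \<circ> \<sigma>" "i \<in> S" "j \<in> S"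
  shows "\<exists>\<sigma>. \<sigma> permutes S \<and> swap_at B i j = A \<circ> \<sigma>"
  using permutes_compose[OF permutes_swap_id[OF assms(3,4)] assms(1)] assms(2)
  by (auto simp: swap_at_conv_transpose comp_assoc)

lemma partition_loop_correct:
  assumes "partition_loop A p q a a b c = (A', l', g', c')" "q \<notin> A ` {a..b}" "p < q" "a \<le> b + 1"
  shows "\<exists>\<sigma>. \<sigma> permutes {a..b} \<and> A' = A \<circ> \<sigma>"
    and "a \<le> l'" "l' \<le> g' + 1" "g' \<le> b"
    and "\<forall>i\<in>{a..<l'}. A' i < p" "\<forall>i\<in>{l'..g'}. p \<le> A' i \<and> A' i < q" "\<forall>i\<in>{g'<..b}. q \<le> A' i"
proof -
  define Rearr where "Rearr B \<longleftrightarrow> (\<exists>\<sigma>. \<sigma> permutes {a..b} \<and> B = A \<circ> \<sigma>)" for B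
  \<comment> \<open>When a large element is met at \<open>k1 = g1\<close>, both indices move past
    each other and \<open>k1\<close> ends at \<open>g1 + 2\<close>. Hence that bound and the guard
    \<open>i \<le> g1\<close> in the clause for medium elements.\<close>
  define I where "I = (\<lambda>A1 l1 k1 g1 (c1 :: nat). Rearr A1 \<and>
    a \<le> l1 \<and> l1 \<le> k1 \<and> l1 \<le> g1 + 1 \<and> k1 \<le> g1 + 2 \<and> g1 \<le> b \<and> (\<forall>i\<in>{a..<l1}. A1 i < p) \<and>
    (\<forall>i. l1 \<le> i \<longrightarrow> i < k1 \<longrightarrow> i \<le> g1 \<longrightarrow> p \<le> A1 i \<and> A1 i < q) \<and> (\<forall>i\<in>{g1<..b}. q \<le> A1 i))"
  have I: "I A a a b c" using assms(4) by (auto simp: I_def Rearr_def intro!: exI[of _ id] permutes_id)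
  \<comment> \<open>A stopped scan yields only \<open>A1 h \<le> q\<close>, while the clause for
    medium elements is strict.\<close>
  have no_q: "A1 i \<noteq> q" if I1: "I A1 l1 k1 g1 c1" and i: "i \<in> {a..b}" for A1 l1 k1 g1 c1 i
  proof -
    obtain \<sigma> where \<sigma>: "\<sigma> permutes {a..b}" "A1 = A \<circ> \<sigma>" using I1 unfolding I_def Rearr_def by blast
    from permutes_in_image[OF this(1), of i] i have "\<sigma> i \<in> {a..b}" by simp
    then show ?thesis using \<sigma>(2) assms(2) by auto
  qed
  have perm: "Rearr (swap_at B i j)"
    if "Rearr B" "i \<in> {a..b}" "j \<in> {a..b}" for B i j
    using that swap_at_permutes[of _ "{a..b}" B A i j] unfolding Rearr_def by blast
  have "\<exists>k'>g'. I A' l' k' g' c'"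
    using assms(1) I
  proof (induction rule: partition_loop_rule)
    case (small A1 l1 k1 g1 c1)
    have p: "Rearr (swap_at A1 k1 l1)" using perm[of A1 k1 l1] small by (simp add: I_def)
    show ?case unfolding I_def
      using small p by (auto simp: I_def) (auto simp: swap_at_def)
  next
    case (medium A1 l1 k1 g1 c1)
    have "p \<le> A1 i \<and> A1 i < q" if "l1 \<le> i" "i < k1 + 1" "i \<le> g1" for i
      using medium that by (cases "i = k1") (auto simp: I_def)
    with medium show ?case by (auto simp: I_def)
  next
    case (large_ge A1 l1 k1 g1 c1 h)
    have b: "a \<le> l1" "l1 \<le> k1" "g1 \<le> b" using large_ge by (auto simp: I_def)
    have hq: "A1 h < q" if "k1 < h"
      using large_ge(7)[OF that] no_q[OF large_ge(1), of h] that b large_ge(5) by (simp add: order_less_le)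
    have p: "Rearr (swap_at A1 k1 h)"
      using perm[of A1 k1 h] large_ge b by (simp add: I_def)
    have big: "q \<le> swap_at A1 k1 h i" if ih: "i \<in> {h - 1<..b}" for i
    proof -
      consider "i = h" | "i \<in> {h<..g1}" | "i \<in> {g1<..b}" using ih by force
      then show ?thesis using large_ge(1,3-6) by cases (auto simp: swap_at_def I_def intro: less_imp_le)
    qed
    show ?case unfolding I_def
      using large_ge b p big hq by (auto simp: I_def) (auto simp: swap_at_def)
  next
    case (large_less A1 l1 k1 g1 c1 h)
    have kh: "k1 < h" using large_less(2,4,8) by (cases "k1 = h") auto
    have b: "a \<le> l1" "l1 \<le> k1" "g1 \<le> b" using large_less by (auto simp: I_def)
    have p: "Rearr (swap_at A1 k1 h)"
      using perm[of A1 k1 h] large_less b by (simp add: I_def)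
    have p: "Rearr (swap_at (swap_at A1 k1 h) k1 l1)"
      using perm[OF p, of k1 l1] large_less b by (simp add: I_def)
    have big: "q \<le> swap_at (swap_at A1 k1 h) k1 l1 i" if ih: "i \<in> {h - 1<..b}" for i
    proof -
      consider "i = h" | "i \<in> {h<..g1}" | "i \<in> {g1<..b}" using ih by force
      then show ?thesis using large_less(1,3-6) kh b
        by cases (auto simp: swap_at_def I_def intro: less_imp_le)
    qed
    show ?case unfolding I_def
      using large_less b p big kh by (auto simp: I_def) (auto simp: swap_at_def)
  qed
  then obtain k' where k': "g' < k'" "I A' l' k' g' c'" by auto
  then show "\<exists>\<sigma>. \<sigma> permutes {a..b} \<and> A' = A \<circ> \<sigma>"
    and "a \<le> l'" "l' \<le> g' + 1" "g' \<le> b"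
    and "\<forall>i\<in>{a..<l'}. A' i < p" "\<forall>i\<in>{l'..g'}. p \<le> A' i \<and> A' i < q" "\<forall>i\<in>{g'<..b}. q \<le> A' i"
    by (auto simp: I_def Rearr_def)
qed

lemma partition_step_correct:
  fixes A :: "int \<Rightarrow> 'a::linorder"
  defines "p \<equiv> \<lambda>L R. min (A L) (A R)" and "q \<equiv> \<lambda>L R. max (A L) (A R)"
  assumes run: "partition_step A L R = (A', l, g, c)" and inj: "inj_on A {L..R}" and "L < R"
  shows "\<exists>\<sigma>. \<sigma> permutes {L..R} \<and> A' = A \<circ> \<sigma>"
    and "L \<le> l" "l < g" "g \<le> R" "A' l = p L R" "A' g = q L R"
    and "\<forall>i\<in>{L..<l}. A' i < p L R" "\<forall>i\<in>{l<..<g}. p L R < A' i \<and> A' i < q L R"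
      "\<forall>i\<in>{g<..R}. q L R < A' i"
    and "c = 1 + partition_cost A (p L R) (q L R) (R - 1 - int (card {i\<in>{L+1..R-1}. q L R < A i})) (L+1) (R-1)"
proof -
  define P where "P = p L R"
  define Q where "Q = q L R"
  have PQ: "P < Q" "P \<in> {A L, A R}" "Q \<in> {A L, A R}"
    using inj_onD[OF inj, of L R] \<open>L < R\<close> by (force simp: P_def Q_def p_def q_def min_def max_def)+
  have Q: "Q \<notin> A ` {L+1..R-1}"
  proof
    assume "Q \<in> A ` {L+1..R-1}"
    then obtain i where "i \<in> {L+1..R-1}" "A i = A L \<or> A i = A R" using PQ(3) by auto
    then show False using inj_onD[OF inj, of i L] inj_onD[OF inj, of i R] by auto
  qed
  obtain A1 l1 g1 c1 where
    loop: "partition_loop A P Q (L + 1) (L + 1) (R - 1) 1 = (A1, l1, g1, c1)"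
    by (metis prod_cases4)
  have pq_if: "(if A R < A L then (A R, A L) else (A L, A R)) = (P, Q)"
    by (auto simp: P_def Q_def p_def q_def)
  have eqs: "l = l1 - 1" "g = g1 + 1" "c = c1"
    "A' = (A1(L := A1 l, l := P))(R := (A1(L := A1 l, l := P)) g, g := Q)"
    using run loop unfolding partition_step_def pq_if by (auto simp: Let_def)
  note spec = partition_loop_correct[OF loop Q PQ(1)]
  obtain \<sigma> where \<sigma>: "\<sigma> permutes {L+1..R-1}" "A1 = A \<circ> \<sigma>" using spec(1) \<open>L < R\<close> by auto
  have A1: "A1 L = A L" "A1 R = A R" using \<sigma> by (auto simp: permutes_def)
  show b: "L \<le> l" "l < g" "g \<le> R" using spec(2-4) \<open>L < R\<close> by (auto simp: eqs)
  \<comment> \<open>The closing assignments become two transpositions once the pivots are put in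
    order in the array; the procedure orders them only in the variables \<open>p\<close> and
    \<open>q\<close>.\<close>
  define S where "S = (if A R < A L then swap_at A1 L R else A1)"
  have A': "A' = swap_at (swap_at S L l) R g"
    using b A1 by (auto simp: S_def swap_at_def eqs(4) fun_eq_iff P_def Q_def p_def q_def)
  have "\<sigma> permutes {L..R}" using \<sigma>(1) by (rule permutes_subset) auto
  then have "\<exists>\<sigma>. \<sigma> permutes {L..R} \<and> S = A \<circ> \<sigma>"
    using swap_at_permutes[OF _ \<sigma>(2), of "{L..R}" L R] \<sigma>(2) \<open>L < R\<close> by (auto simp: S_def)
  then have "\<exists>\<sigma>. \<sigma> permutes {L..R} \<and> swap_at S L l = A \<circ> \<sigma>"
    using swap_at_permutes[of _ "{L..R}" S A L l] b by auto
  then show perm: "\<exists>\<sigma>. \<sigma> permutes {L..R} \<and> A' = A \<circ> \<sigma>"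
    using swap_at_permutes[of _ "{L..R}" "swap_at S L l" A R g] b A' by auto
  then obtain \<rho> where \<rho>: "\<rho> permutes {L..R}" "A' = A \<circ> \<rho>" by auto
  have "\<rho> ` {L..R} = {L..R}" "inj_on \<rho> {L..R}"
    using \<rho>(1) by (auto simp: permutes_image permutes_inj_on)
  then have inj': "inj_on A' {L..R}" unfolding \<rho>(2) using inj by (auto intro!: comp_inj_on)
  show Al: "A' l = p L R" and Ag: "A' g = q L R" using b by (auto simp: eqs(4) P_def Q_def)
  show "\<forall>i\<in>{L..<l}. A' i < p L R"
    using spec(5) b \<open>L < R\<close> by (auto simp: eqs P_def)
  have "P \<le> A' i \<and> A' i < Q" if "i \<in> {l<..<g}" for i
    using spec(6) that b \<open>L < R\<close> by (auto simp: eqs)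
  moreover have "A' i \<noteq> P" if "i \<in> {l<..<g}" for i
    using inj_onD[OF inj', of i l] that b Al by (auto simp: P_def)
  ultimately show "\<forall>i\<in>{l<..<g}. p L R < A' i \<and> A' i < q L R"
    by (force simp: P_def Q_def order_less_le)
  have "Q \<le> A' i" if "i \<in> {g<..R}" for i
    using spec(7) that b \<open>L < R\<close> by (auto simp: eqs)
  moreover have "A' i \<noteq> Q" if "i \<in> {g<..R}" for i
    using inj_onD[OF inj', of i g] that b Ag by (auto simp: Q_def)
  ultimately show "\<forall>i\<in>{g<..R}. q L R < A' i"
    by (force simp: Q_def order_less_le)
  show "c = 1 + partition_cost A (p L R) (q L R) (R - 1 - int (card {i\<in>{L+1..R-1}. q L R < A i})) (L+1) (R-1)"
    using partition_loop_cost[OF loop Q PQ(1) refl] by (simp add: eqs P_def Q_def)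
qed

section \<open>Partitioning under translation of positions and relabelling of keys\<close>

lemma scan_down_shift:
  assumes "\<forall>i\<in>{k..g}. q' < B (i + d) \<longleftrightarrow> q < A i" "k \<le> g"
    and "scan_down A q k g c = (g', c')"
  shows "scan_down B q' (k + d) (g + d) c = (g' + d, c')"
  using assms
proof (induction A q k g c rule: scan_down.induct)
  case (1 A q k g c)
  have iff: "q' < B (g + d) \<longleftrightarrow> q < A g" using "1.prems" by auto
  show ?case
  proof (cases "A g > q \<and> k < g")
    case True
    with "1.prems" have "scan_down A q k (g - 1) (c + 1) = (g', c')"
      by (subst (asm) scan_down.simps) simp
    from "1.IH"[OF True _ _ this] True "1.prems"
    have "scan_down B q' (k + d) (g - 1 + d) (c + 1) = (g' + d, c')" by auto
    then show ?thesis using True iff by (subst scan_down.simps) (simp add: algebra_simps)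
  next
    case False
    with "1.prems" have "g' = g" "c' = c + 1"
      by (subst (asm) scan_down.simps; auto)+
    then show ?thesis using False iff by (subst scan_down.simps) auto
  qed
qed

text \<open>Only comparisons with the one key \<open>p\<close> must survive, so relabellings that
  shuffle keys within a class qualify although they are not monotone.\<close>

definition order_compat :: "('a::linorder \<Rightarrow> 'b::linorder) \<Rightarrow> 'a set \<Rightarrow> 'a \<Rightarrow> bool" where
  "order_compat h S p \<longleftrightarrow> (\<forall>x\<in>S. (h x < h p \<longleftrightarrow> x < p) \<and> (h p < h x \<longleftrightarrow> p < x))"

definition shifted :: "int \<Rightarrow> int \<Rightarrow> int \<Rightarrow> ('a \<Rightarrow> 'b) \<Rightarrow> (int \<Rightarrow> 'a) \<Rightarrow> (int \<Rightarrow> 'b) \<Rightarrow> bool" where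
  "shifted L R d h A B \<longleftrightarrow> (\<forall>i\<in>{L..R}. B (i + d) = h (A i))"

lemma shifted_swap_at:
  assumes "shifted L R d h A B" "i \<in> {L..R}" "j \<in> {L..R}"
  shows "shifted L R d h (swap_at A i j) (swap_at B (i + d) (j + d))"
  using assms by (auto simp: shifted_def swap_at_def)

lemma swap_at_image:
  assumes "A ` {L..R} \<subseteq> S" "i \<in> {L..R}" "j \<in> {L..R}"
  shows "swap_at A i j ` {L..R} \<subseteq> S"
  using assms by (auto simp: swap_at_def)

lemma partition_loop_shift:
  assumes "partition_loop A p q l k g c = (A', l', g', c')"
    and "shifted L R d h A B" "A ` {L..R} \<subseteq> S" "order_compat h S p" "order_compat h S q"
    and "L \<le> l" "l \<le> k" "g \<le> R"
  shows "\<exists>B'. partition_loop B (h p) (h q) (l + d) (k + d) (g + d) c = (B', l' + d, g' + d, c') \<and>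
    shifted L R d h A' B'"
  using assms(1-3,6-)
proof (induction "nat (g + 1 - k)" arbitrary: A B l k g c rule: less_induct)
  case less
  note run = less.prems(1) and sh = less.prems(2) and S = less.prems(3)
    and b = less.prems(4-)
  have cmp: "B (i + d) < h p \<longleftrightarrow> A i < p" "h p \<le> B (i + d) \<longleftrightarrow> p \<le> A i"
     "h q \<le> B (i + d) \<longleftrightarrow> q \<le> A i" "h q < B (i + d) \<longleftrightarrow> q < A i" if "i \<in> {L..R}" for i
    using sh S assms(4,5) that unfolding shifted_def order_compat_def
    by (auto simp: image_subset_iff simp flip: not_less)
  show ?case
  proof (cases "k \<le> g")
    case False
    with run sh show ?thesis
      by (subst (asm) partition_loop.simps, subst partition_loop.simps) auto
  next
    case kg: True
    have kR: "k \<in> {L..R}" "l \<in> {L..R}" using kg b by auto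
    consider "A k < p" | "p \<le> A k" "A k < q" | "p \<le> A k" "q \<le> A k" by force
    then show ?thesis
    proof cases
      case 1
      with run kg have "partition_loop (swap_at A k l) p q (l + 1) (k + 1) g (c + 1) = (A', l', g', c')"
        by (subst (asm) partition_loop.simps) simp
      from less.hyps[OF _ this shifted_swap_at[OF sh kR] swap_at_image[OF S kR]] kg b
      show ?thesis using 1 cmp[OF kR(1)]
        by (subst partition_loop.simps) (simp add: add_ac)
    next
      case 2
      then have n: "\<not> A k < p" "\<not> q \<le> A k" by auto
      with run kg have "partition_loop A p q l (k + 1) g (c + 2) = (A', l', g', c')"
        by (subst (asm) partition_loop.simps) simp
      from less.hyps[OF _ this sh S] kg b
      show ?thesis using n cmp[OF kR(1)]
        by (subst partition_loop.simps) (simp add: add_ac)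
    next
      case 3
      then have n: "\<not> A k < p" by auto
      obtain e f where ef: "scan_down A q k g (c + 2) = (e, f)" by force
      note bs = scan_down_bounds[OF ef]
      have eR: "e \<in> {L..R}" using bs kg b by auto
      have ef': "scan_down B (h q) (k + d) (g + d) (c + 2) = (e + d, f)"
        by (rule scan_down_shift[OF _ kg ef]) (use cmp b in auto)
      show ?thesis
      proof (cases "p \<le> A e")
        case True
        with run kg 3 n ef have "partition_loop (swap_at A k e) p q l (k + 1) (e - 1)
            (f + 1) = (A', l', g', c')"
          by (subst (asm) partition_loop.simps) simp
        from less.hyps[OF _ this shifted_swap_at[OF sh kR(1) eR] swap_at_image[OF S kR(1) eR]]
          kg b bs
        show ?thesis using 3 n True ef' cmp[OF kR(1)] cmp[OF eR]
          by (subst partition_loop.simps) (simp add: algebra_simps)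
      next
        case False
        with run kg 3 n ef have "partition_loop (swap_at (swap_at A k e) k l) p q (l + 1) (k + 1)
            (e - 1) (f + 1) = (A', l', g', c')"
          by (subst (asm) partition_loop.simps) simp
        from less.hyps[OF _ this shifted_swap_at[OF shifted_swap_at[OF sh kR(1) eR] kR]
            swap_at_image[OF swap_at_image[OF S kR(1) eR] kR]]
          kg b bs
        show ?thesis using 3 n False ef' cmp[OF kR(1)] cmp[OF eR]
          by (subst partition_loop.simps) (simp add: algebra_simps)
      qed
    qed
  qed
qed

text \<open>Serves two purposes: with a translation and a strictly monotone \<open>h\<close> it
  compares a subarray with an array of its own; with \<open>d = 0\<close> and a permutation of one
  class of keys it gives uniformity of the subarrays.\<close>

lemma partition_step_shift:
  assumes run: "partition_step A L R = (A', l, g, c)"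
    and sh: "shifted L R d h A B"
    and compat: "order_compat h (A ` {L..R}) (A L)" "order_compat h (A ` {L..R}) (A R)"
    and "inj_on A {L..R}" "L < R"
  shows "\<exists>B'. partition_step B (L + d) (R + d) = (B', l + d, g + d, c) \<and> shifted L R d h A' B'"
proof -
  define p where "p = (if A R < A L then A R else A L)"
  define q where "q = (if A R < A L then A L else A R)"
  obtain A1 l1 g1 c1 where
    loop: "partition_loop A p q (L + 1) (L + 1) (R - 1) 1 = (A1, l1, g1, c1)"
    by (metis prod_cases4)
  have "order_compat h (A ` {L..R}) p" "order_compat h (A ` {L..R}) q"
    using compat by (auto simp: p_def q_def)
  from partition_loop_shift[OF loop sh order_refl this] \<open>L < R\<close>
  obtain B1 where B1: "partition_loop B (h p) (h q) (L + 1 + d) (L + 1 + d) (R - 1 + d) 1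
      = (B1, l1 + d, g1 + d, c1)" and sh1: "shifted L R d h A1 B1"
    by auto
  have "B (R + d) = h (A R)" "B (L + d) = h (A L)" "h (A R) < h (A L) \<longleftrightarrow> A R < A L"
    using sh compat \<open>L < R\<close> by (auto simp: shifted_def order_compat_def)
  then have pqB: "(if B (R + d) < B (L + d) then (B (R + d), B (L + d)) else (B (L + d), B (R + d)))
      = (h p, h q)" by (auto simp: p_def q_def)
  have pqA: "(if A R < A L then (A R, A L) else (A L, A R)) = (p, q)"
    by (auto simp: p_def q_def)
  have eqs: "l = l1 - 1" "g = g1 + 1" "c = c1"
    "A' = (A1(L := A1 l, l := p))(R := (A1(L := A1 l, l := p)) g, g := q)"
    using run loop unfolding partition_step_def pqA by (auto simp: Let_def)
  note b = partition_step_correct(2-4)[OF run assms(5,6)]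
  define B' where "B' = (B1(L + d := B1 (l + d), l + d := h p))
    (R + d := (B1(L + d := B1 (l + d), l + d := h p)) (g + d), g + d := h q)"
  have "partition_step B (L + d) (R + d) = (B', l + d, g + d, c)"
    using B1 unfolding partition_step_def pqB B'_def eqs by (simp add: Let_def algebra_simps)
  moreover have "shifted L R d h A' B'"
    using sh1 b unfolding shifted_def eqs(4) B'_def by auto
  ultimately show ?thesis by blast
qed

subsection \<open>Insertion sort\<close>

text \<open>In a sorted prefix each larger key costs one successful comparison. A failing one
  follows unless the index runs off the left end, that is, unless all keys of the prefix are
  larger.\<close>

lemma insert_loop_correct:
  assumes "insert_loop A v L j c = (A', c')" "L \<le> j + 1"
  shows "(\<forall>i. i \<notin> {L..j+1} \<longrightarrow> A' i = A i) \<and> A' ` {L..j+1} = insert v (A ` {L..j}) \<and>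
    (mono_on {L..j} A \<longrightarrow> mono_on {L..j+1} A' \<and>
      c' = c + card {i\<in>{L..j}. v < A i} + of_bool (\<exists>i\<in>{L..j}. A i \<le> v))"
  using assms
proof (induction A v L j c rule: insert_loop.induct)
  case (1 A v L j c)
  note run = "1.prems"(1)
  consider "j < L" | "L \<le> j" "v < A j" | "L \<le> j" "A j \<le> v" by force
  then show ?case
  proof cases
    case 1
    then have "L = j + 1" using "1.prems"(2) by simp
    moreover from run 1 have "A' = A(j + 1 := v)" "c' = c"
      by (subst (asm) insert_loop.simps; simp)+
    ultimately show ?thesis by (auto simp: mono_on_def)
  next
    case 2
    let ?A = "A(j + 1 := A j)"
    from run 2 have "insert_loop ?A v L (j - 1) (c + 1) = (A', c')"
      by (subst (asm) insert_loop.simps) simp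
    note IH0 = "1.IH"[OF 2 this, unfolded diff_add_cancel, OF 2(1)]
    have IH:
      "\<And>i. i \<notin> {L..j} \<Longrightarrow> A' i = ?A i" "A' ` {L..j} = insert v (?A ` {L..j-1})"
      "mono_on {L..j-1} ?A \<Longrightarrow> mono_on {L..j} A' \<and>
      c' = c + 1 + card {i\<in>{L..j-1}. v < ?A i} + of_bool (\<exists>i\<in>{L..j-1}. ?A i \<le> v)"
      using IH0 by blast+
    have last: "A' (j + 1) = A j" using IH(1)[of "j + 1"] by simp
    have eq: "?A ` {L..j-1} = A ` {L..j-1}" by auto
    have ins: "{L..j+1} = insert (j+1) {L..j}" "{L..j} = insert j {L..j-1}" using 2 by auto
    have "A' ` {L..j+1} = insert v (A ` {L..j})"
      unfolding ins(1) image_insert IH(2) eq last by (subst ins(2)) auto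
    moreover have "mono_on {L..j+1} A' \<and>
      c' = c + card {i\<in>{L..j}. v < A i} + of_bool (\<exists>i\<in>{L..j}. A i \<le> v)" if m: "mono_on {L..j} A"
    proof -
      have "mono_on {L..j-1} ?A" using m by (auto simp: mono_on_def)
      note IH' = IH(3)[OF this]
      have le: "x \<le> A j" if "x \<in> A' ` {L..j}" for x
        using that m 2 unfolding IH(2) eq by (auto simp: mono_on_def)
      have "mono_on {L..j+1} A'"
      proof (rule mono_onI)
        fix r s assume rs: "r \<in> {L..j+1}" "s \<in> {L..j+1}" "r \<le> s"
        then consider "s \<in> {L..j}" "r \<in> {L..j}" | "r = j + 1" "s = j + 1" | "r \<in> {L..j}" "s = j + 1"
          by force
        then show "A' r \<le> A' s"
        proof cases
          case 1
          with IH' rs(3) show ?thesis by (blast intro: mono_onD)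
        qed (use le last in simp_all)
      qed
      moreover have "{i\<in>{L..j}. v < A i} = insert j {i\<in>{L..j-1}. v < ?A i}" using 2 by auto
      moreover have "finite {i\<in>{L..j-1}. v < ?A i}" by (rule finite_subset[of _ "{L..j}"]) auto
      then have "card (insert j {i\<in>{L..j-1}. v < ?A i}) = Suc (card {i\<in>{L..j-1}. v < ?A i})"
        by (rule card_insert_disjoint) auto
      moreover have "(\<exists>i\<in>{L..j}. A i \<le> v) \<longleftrightarrow> (\<exists>i\<in>{L..j-1}. ?A i \<le> v)"
        unfolding ins(2) using 2 by auto
      ultimately show ?thesis using IH' by (simp only: of_bool_eq) simp
    qed
    moreover have "A' i = A i" if "i \<notin> {L..j+1}" for i
      using IH(1)[of i] that 2(1) by auto
    ultimately show ?thesis by blast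
  next
    case 3
    from run 3 have eqs: "A' = A(j + 1 := v)" "c' = c + 1"
      by (subst (asm) insert_loop.simps; simp add: leD)+
    have ins: "{L..j+1} = insert (j+1) {L..j}" using 3 by auto
    have "A' ` {L..j+1} = insert v (A ` {L..j})" unfolding ins by (auto simp: eqs)
    moreover have "mono_on {L..j+1} A' \<and>
      c' = c + card {i\<in>{L..j}. v < A i} + of_bool (\<exists>i\<in>{L..j}. A i \<le> v)" if m: "mono_on {L..j} A"
    proof -
      have le: "A i \<le> v" if "i \<in> {L..j}" for i
        using m that 3 by (auto simp: mono_on_def intro: order_trans[of _ "A j"])
      then have "{i\<in>{L..j}. v < A i} = {}" by (force simp: not_less)
      then have "card {i\<in>{L..j}. v < A i} = 0" by (simp only: card.empty)
      moreover have "mono_on {L..j+1} A'" using m le by (auto simp: mono_on_def eqs)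
      moreover have "\<exists>i\<in>{L..j}. A i \<le> v" using 3 by (intro bexI[of _ j]) auto
      ultimately show ?thesis by (simp add: eqs(2))
    qed
    moreover have "\<forall>i. i \<notin> {L..j+1} \<longrightarrow> A' i = A i" using 3 by (auto simp: eqs(1))
    ultimately show ?thesis by blast
  qed
qed

text \<open>For distinct keys: inversions plus positions that are not left-to-right minima. It can
  be read off the initial array because sorting a prefix does not change its set of keys.\<close>

definition insertion_cost :: "(int \<Rightarrow> 'a::linorder) \<Rightarrow> int \<Rightarrow> int \<Rightarrow> nat" where
  "insertion_cost A L R =
    (\<Sum>i\<in>{L<..R}. card {j\<in>{L..<i}. A i < A j} + of_bool (\<exists>j\<in>{L..<i}. A j < A i))"

lemma insertion_sort_correct:
  assumes "insertion_sort A L R = (A', c)" "inj_on A {L..R}"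
  shows "i \<notin> {L..R} \<Longrightarrow> A' i = A i" "c = insertion_cost A L R"
proof -
  have *: "(\<forall>i. i \<notin> {L..R} \<longrightarrow> A' i = A i) \<and> A' ` {L..R} = A ` {L..R} \<and> mono_on {L..R} A' \<and>
    c = insertion_cost A L R" if "L \<le> R"
    using that assms
  proof (induction R arbitrary: A' c rule: int_ge_induct)
    case base
    then show ?case by (auto simp: insertion_sort_def insertion_cost_def mono_on_def)
  next
    case (step R)
    obtain B b where B: "insertion_sort A L R = (B, b)" by force
    from step.prems(2) have inj: "inj_on A {L..R}" by (rule inj_on_subset) auto
    note IH = step.IH[OF B inj]
    have run: "insert_loop B (B (R + 1)) L R b = (A', c)"
      using step.prems(1) B step.hyps by (simp add: insertion_sort_def upto_rec2)
    have v: "B (R + 1) = A (R + 1)" using IH by auto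
    note spec = insert_loop_correct[OF run]
    have "card (B ` {L..R}) = card {L..R}" using IH inj by (simp add: card_image)
    then have injB: "inj_on B {L..R}" by (intro eq_card_imp_inj_on) auto
    \<comment> \<open>The sorted prefix of \<open>B\<close> has the keys of the prefix of
      \<open>A\<close> at other positions, so positions are counted through their keys.\<close>
    have "card {i\<in>{L..R}. A (R+1) < B i} = card (B ` {i\<in>{L..R}. A (R+1) < B i})"
      by (rule card_image[symmetric], rule inj_on_subset[OF injB]) auto
    also have "B ` {i\<in>{L..R}. A (R+1) < B i} = {x \<in> B ` {L..R}. A (R+1) < x}" by auto
    also have "\<dots> = {x \<in> A ` {L..R}. A (R+1) < x}" using IH by simp
    also have "\<dots> = A ` {i\<in>{L..R}. A (R+1) < A i}" by auto
    also have "card \<dots> = card {i\<in>{L..R}. A (R+1) < A i}"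
      by (rule card_image, rule inj_on_subset[OF inj]) auto
    finally have cards: "card {i\<in>{L..R}. A (R+1) < B i} = card {i\<in>{L..R}. A (R+1) < A i}" .
    have "(\<exists>i\<in>{L..R}. B i \<le> A (R+1)) \<longleftrightarrow> (\<exists>x\<in>B ` {L..R}. x \<le> A (R+1))" by auto
    also have "\<dots> \<longleftrightarrow> (\<exists>x\<in>A ` {L..R}. x \<le> A (R+1))" using IH by simp
    also have "\<dots> \<longleftrightarrow> (\<exists>i\<in>{L..R}. A i < A (R+1))"
      using inj_onD[OF step.prems(2), of _ "R + 1"] by (fastforce simp: order_less_le)
    finally have ex: "(\<exists>i\<in>{L..R}. B i \<le> A (R+1)) \<longleftrightarrow> (\<exists>i\<in>{L..R}. A i < A (R+1))" .
    have sets: "{L..<R+1} = {L..R}" "{L<..R+1} = insert (R+1) {L<..R}" using step.hyps by auto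
    have "insertion_cost A L (R + 1) = insertion_cost A L R +
        (card {i\<in>{L..R}. A (R+1) < A i} + of_bool (\<exists>i\<in>{L..R}. A i < A (R+1)))"
      unfolding insertion_cost_def sets(2) by (subst sum.insert) (auto simp: sets(1))
    then have "c = insertion_cost A L (R + 1)" using spec IH step.hyps v cards ex by simp
    have "{L..R+1} = insert (R+1) {L..R}" using step.hyps by auto
    then have "insert (A (R+1)) (A ` {L..R}) = A ` {L..R+1}" by simp
    moreover have "A' ` {L..R+1} = insert (A (R+1)) (A ` {L..R})" using spec IH v step.hyps by simp
    ultimately have "A' ` {L..R+1} = A ` {L..R+1}" by simp
    moreover note \<open>c = _\<close>
    ultimately show ?case using spec IH step.hyps by auto
  qed
  have "A' = A \<and> c = insertion_cost A L R" if "\<not> L \<le> R"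
    using assms(1) that by (auto simp: insertion_sort_def insertion_cost_def)
  with * show "i \<notin> {L..R} \<Longrightarrow> A' i = A i" "c = insertion_cost A L R" by blast+
qed

lemma insertion_cost_shift:
  assumes "shifted L R d h A B" "\<And>x y. x \<in> A ` {L..R} \<Longrightarrow> y \<in> A ` {L..R} \<Longrightarrow> h x < h y \<longleftrightarrow> x < y"
  shows "insertion_cost B (L + d) (R + d) = insertion_cost A L R"
proof -
  have lt: "B (i + d) < B (j + d) \<longleftrightarrow> A i < A j" if "i \<in> {L..R}" "j \<in> {L..R}" for i j
    using assms that by (auto simp: shifted_def)
  have shift: "(\<lambda>j. j + d) ` {a<..b} = {a + d<..b + d}" for a b
    using image_add_greaterThanAtMost[of d a b] by (simp add: add.commute)
  have "insertion_cost B (L + d) (R + d) = (\<Sum>i\<in>{L<..R}.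
      card {j\<in>{L+d..<i+d}. B (i+d) < B j} + of_bool (\<exists>j\<in>{L+d..<i+d}. B j < B (i+d)))"
    unfolding insertion_cost_def shift[symmetric] by (subst sum.reindex) auto
  also have "\<dots> = insertion_cost A L R"
    unfolding insertion_cost_def
  proof (intro sum.cong refl)
    fix i assume i: "i \<in> {L<..R}"
    have "{j\<in>{L+d..<i+d}. B (i+d) < B j} = (\<lambda>j. j + d) ` {j\<in>{L..<i}. A i < A j}"
      (is "?S = ?T")
    proof (intro set_eqI iffI)
      fix x assume "x \<in> ?S"
      then show "x \<in> ?T" using lt[of i "x - d"] i by (intro image_eqI[of _ _ "x - d"]) auto
    qed (use lt i in auto)
    then have "card {j\<in>{L+d..<i+d}. B (i+d) < B j} = card {j\<in>{L..<i}. A i < A j}"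
      by (simp add: card_image)
    moreover have "(\<exists>j\<in>{L+d..<i+d}. B j < B (i+d)) \<longleftrightarrow> (\<exists>j\<in>{L..<i}. A j < A i)"
      (is "?S \<longleftrightarrow> ?T")
    proof
      assume ?S
      then obtain x where "x \<in> {L+d..<i+d}" "B x < B (i + d)" by blast
      then show ?T using lt[of "x - d" i] i by (intro bexI[of _ "x - d"]) auto
    next
      assume ?T
      then obtain x where "x \<in> {L..<i}" "A x < A i" by blast
      then show ?S using lt[of x i] i by (intro bexI[of _ "x + d"]) auto
    qed
    ultimately show "card {j\<in>{L+d..<i+d}. B (i+d) < B j} + of_bool (\<exists>j\<in>{L+d..<i+d}. B j < B (i+d))
      = card {j\<in>{L..<i}. A i < A j} + of_bool (\<exists>j\<in>{L..<i}. A j < A i)" by simp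
  qed
  finally show ?thesis .
qed

subsection \<open>The number of comparisons depends only on the relative order\<close>

lemma comp_permutes_properties:
  assumes "\<sigma> permutes S" "B = A \<circ> \<sigma>"
  shows "i \<notin> S \<Longrightarrow> B i = A i" "B ` S = A ` S" "inj_on A S \<Longrightarrow> inj_on B S"
proof -
  show "i \<notin> S \<Longrightarrow> B i = A i" using assms by (simp add: permutes_def)
  have img: "\<sigma> ` S = S" using assms(1) by (rule permutes_image)
  show "B ` S = A ` S" unfolding assms(2) image_comp[symmetric] img ..
  show "inj_on B S" if "inj_on A S"
    unfolding assms(2) using that assms(1) img by (intro comp_inj_on) (auto simp: permutes_inj_on)
qed

lemma inj_on_eq_subset:
  assumes "inj_on A S" "T \<subseteq> S" "\<And>i. i \<in> T \<Longrightarrow> B i = A i"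
  shows "inj_on B T"
  using assms by (auto simp: inj_on_def)

text \<open>The three recursive calls work one after another on the same array; this shows that none
  disturbs the segments of the others.\<close>

lemma quicksort_outside:
  assumes "inj_on A {L..R}" "M \<ge> 1" "i \<notin> {L..R}"
  shows "fst (quicksort M A L R) i = A i"
  using assms(1,3)
proof (induction "nat (R + 1 - L)" arbitrary: A L R i rule: less_induct)
  case less
  note inj = less.prems(1) and i = less.prems(2)
  show ?case
  proof (cases "R - L < int M")
    case True
    obtain A' c where "insertion_sort A L R = (A', c)" by force
    then show ?thesis using insertion_sort_correct(1)[OF _ inj i] True
      by (subst quicksort.simps) simp
  next
    case False
    then have "L < R" using assms(2) by linarith
    obtain A0 l g c0 where step: "partition_step A L R = (A0, l, g, c0)" by (metis prod_cases4)
    note spec = partition_step_correct[OF step inj \<open>L < R\<close>]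
    obtain \<sigma> where \<sigma>: "\<sigma> permutes {L..R}" "A0 = A \<circ> \<sigma>" using spec(1) by blast
    note props = comp_permutes_properties[OF \<sigma>]
    obtain A1 c1 where q1: "quicksort M A0 L (l - 1) = (A1, c1)" by force
    obtain A2 c2 where q2: "quicksort M A1 (l + 1) (g - 1) = (A2, c2)" by force
    obtain A3 c3 where q3: "quicksort M A2 (g + 1) R = (A3, c3)" by force
    have A1: "A1 j = A0 j" if "j \<notin> {L..l - 1}" for j
      using less.hyps[of "l - 1" L A0 j] that q1 spec(2-4) inj_on_eq_subset[OF props(3)[OF inj], of "{L..l - 1}" A0]
      by force
    have "inj_on A1 {l + 1..g - 1}"
      by (rule inj_on_eq_subset[OF props(3)[OF inj]]) (use A1 spec(2-4) in auto)
    then have A2: "A2 j = A1 j" if "j \<notin> {l + 1..g - 1}" for j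
      using less.hyps[of "g - 1" "l + 1" A1 j] that q2 spec(2-4) by force
    have "inj_on A2 {g + 1..R}"
      by (rule inj_on_eq_subset[OF props(3)[OF inj]]) (use A1 A2 spec(2-4) in auto)
    then have A3: "A3 j = A2 j" if "j \<notin> {g + 1..R}" for j
      using less.hyps[of R "g + 1" A2 j] that q3 spec(2-4) by force
    have "A3 i = A i" using A1[of i] A2[of i] A3[of i] props(1)[OF i] i spec(2-4) by auto
    then show ?thesis using False step q1 q2 q3 by (subst quicksort.simps) simp
  qed
qed

lemma shifted_trans_eq:
  assumes "shifted L R d h A B" "\<And>i. i \<in> {L..R} \<Longrightarrow> A' i = A i" "\<And>i. i \<in> {L..R} \<Longrightarrow> B' (i + d) = B (i + d)"
  shows "shifted L R d h A' B'"
  using assms by (auto simp: shifted_def)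

lemma shifted_subset: "shifted L R d h A B \<Longrightarrow> L \<le> L' \<Longrightarrow> R' \<le> R \<Longrightarrow> shifted L' R' d h A B"
  by (auto simp: shifted_def)

lemma shifted_inj_on:
  fixes A :: "int \<Rightarrow> 'a::linorder" and B :: "int \<Rightarrow> 'b::linorder"
  assumes "shifted L R d h A B" "strict_mono_on (A ` {L..R}) h" "inj_on A {L..R}"
  shows "inj_on B {L + d..R + d}"
proof (rule inj_onI)
  fix i j assume *: "i \<in> {L + d..R + d}" "j \<in> {L + d..R + d}" "B i = B j"
  then have mem: "i - d \<in> {L..R}" "j - d \<in> {L..R}" by auto
  then have "h (A (i - d)) = h (A (j - d))"
    using assms(1) *(3) unfolding shifted_def by (metis diff_add_cancel)
  then have "\<not> A (i - d) < A (j - d)" "\<not> A (j - d) < A (i - d)"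
    using strict_mono_on_less[OF assms(2), of "A (i - d)" "A (j - d)"]
      strict_mono_on_less[OF assms(2), of "A (j - d)" "A (i - d)"] mem by auto
  then have "A (i - d) = A (j - d)" by auto
  then show "i = j" using inj_onD[OF assms(3) _ mem] by simp
qed

text \<open>Lets a subarray be counted as a permutation of its own. Both runs stay in lockstep, and
  since partitioning only rearranges keys, strict monotonicity of \<open>h\<close> passes to the
  subarrays.\<close>

lemma quicksort_count_shift:
  assumes "M \<ge> 1" "shifted L R d h A B" "strict_mono_on (A ` {L..R}) h" "inj_on A {L..R}"
  shows "snd (quicksort M B (L + d) (R + d)) = snd (quicksort M A L R)"
  using assms(2-)
proof (induction "nat (R + 1 - L)" arbitrary: A B L R rule: less_induct)
  case less
  note sh = less.prems(1) and strict = less.prems(2) and inj = less.prems(3)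
  have injB: "inj_on B {L + d..R + d}" by (rule shifted_inj_on[OF sh strict inj])
  show ?case
  proof (cases "R - L < int M")
    case True
    obtain A' c where A': "insertion_sort A L R = (A', c)" by force
    obtain B' c' where B': "insertion_sort B (L + d) (R + d) = (B', c')" by force
    have "c = c'"
      using insertion_sort_correct(2)[OF A' inj] insertion_sort_correct(2)[OF B' injB]
        insertion_cost_shift[OF sh] strict by (auto simp: strict_mono_on_less)
    then show ?thesis using True A' B'
      by (subst (1 2) quicksort.simps) simp
  next
    case False
    then have "L < R" using assms(1) by linarith
    obtain A0 l g c0 where stepA: "partition_step A L R = (A0, l, g, c0)" by (metis prod_cases4)
    have "order_compat h (A ` {L..R}) (A i)" if "i \<in> {L..R}" for i
      using strict that by (auto simp: order_compat_def strict_mono_on_less)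
    with partition_step_shift[OF stepA sh _ _ inj \<open>L < R\<close>] \<open>L < R\<close>
    obtain B0 where stepB: "partition_step B (L + d) (R + d) = (B0, l + d, g + d, c0)"
      and sh0: "shifted L R d h A0 B0" by auto
    note specA = partition_step_correct[OF stepA inj \<open>L < R\<close>]
    note specB = partition_step_correct[OF stepB injB]
    note b = specA(2-4)
    obtain \<sigma> where \<sigma>: "\<sigma> permutes {L..R}" "A0 = A \<circ> \<sigma>" using specA(1) by blast
    note propsA = comp_permutes_properties[OF \<sigma>]
    obtain \<rho> where \<rho>: "\<rho> permutes {L + d..R + d}" "B0 = B \<circ> \<rho>" using specB(1) \<open>L < R\<close> by auto
    note propsB = comp_permutes_properties[OF \<rho>]
    note injA0 = propsA(3)[OF inj] and injB0 = propsB(3)[OF injB]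
    obtain A1 c1 where q1: "quicksort M A0 L (l - 1) = (A1, c1)" by force
    obtain A2 c2 where q2: "quicksort M A1 (l + 1) (g - 1) = (A2, c2)" by force
    obtain A3 c3 where q3: "quicksort M A2 (g + 1) R = (A3, c3)" by force
    obtain B1 d1 where r1: "quicksort M B0 (L + d) (l + d - 1) = (B1, d1)" by force
    obtain B2 d2 where r2: "quicksort M B1 (l + d + 1) (g + d - 1) = (B2, d2)" by force
    obtain B3 d3 where r3: "quicksort M B2 (g + d + 1) (R + d) = (B3, d3)" by force
    have A1: "A1 i = A0 i" if "i \<notin> {L..l - 1}" for i
      using quicksort_outside[OF inj_on_subset[OF injA0] assms(1) that] q1 b by force
    have B1: "B1 i = B0 i" if "i \<notin> {L + d..l + d - 1}" for i
      using quicksort_outside[OF inj_on_subset[OF injB0] assms(1) that] r1 b by force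
    have inj1: "inj_on A1 {l + 1..g - 1}"
      by (rule inj_on_eq_subset[OF injA0]) (use A1 b in auto)
    have injB1: "inj_on B1 {l + d + 1..g + d - 1}"
      by (rule inj_on_eq_subset[OF injB0]) (use B1 b in auto)
    have A2: "A2 i = A1 i" if "i \<notin> {l + 1..g - 1}" for i
      using quicksort_outside[OF inj1 assms(1) that] q2 by simp
    have B2: "B2 i = B1 i" if "i \<notin> {l + d + 1..g + d - 1}" for i
      using quicksort_outside[OF injB1 assms(1) that] r2 by simp
    have strict0: "strict_mono_on (A0 ` {L..R}) h" using strict propsA(2) by simp
    have "c1 = d1"
      using less.hyps[of "l - 1" L A0 B0, OF _ shifted_subset[OF sh0] monotone_on_subset[OF strict0] inj_on_subset[OF injA0]]
        b q1 r1 by (auto simp: algebra_simps image_mono)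
    moreover have "c2 = d2"
    proof -
      have "A1 ` {l + 1..g - 1} = A0 ` {l + 1..g - 1}" by (rule image_cong) (use A1 in auto)
      then have "strict_mono_on (A1 ` {l + 1..g - 1}) h" using monotone_on_subset[OF strict0, of "A1 ` {l + 1..g - 1}"] b
        by (auto simp: image_mono)
      moreover have "shifted (l + 1) (g - 1) d h A1 B1"
        by (rule shifted_trans_eq[OF shifted_subset[OF sh0]]) (use A1 B1 b in auto)
      ultimately show ?thesis
        using less.hyps[of "g - 1" "l + 1" A1 B1] inj1 b q2 r2 by (auto simp: algebra_simps)
    qed
    moreover have "c3 = d3"
    proof -
      have eqs: "A2 i = A0 i" "B2 (i + d) = B0 (i + d)" if "i \<in> {g + 1..R}" for i
        using A1 A2 B1 B2 that b by auto
      have "A2 ` {g + 1..R} = A0 ` {g + 1..R}" by (rule image_cong) (use eqs in auto)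
      then have "strict_mono_on (A2 ` {g + 1..R}) h" using monotone_on_subset[OF strict0, of "A2 ` {g + 1..R}"] b
        by (auto simp: image_mono)
      moreover have "shifted (g + 1) R d h A2 B2"
        by (rule shifted_trans_eq[OF shifted_subset[OF sh0]]) (use eqs b in auto)
      moreover have "inj_on A2 {g + 1..R}"
        by (rule inj_on_eq_subset[OF injA0]) (use eqs b in auto)
      ultimately show ?thesis
        using less.hyps[of R "g + 1" A2 B2] b q3 r3 by (auto simp: algebra_simps)
    qed
    ultimately show ?thesis
      using False stepA stepB q1 q2 q3 r1 r2 r3 by (subst (1 2) quicksort.simps) simp
  qed
qed

lemma quicksort_count_cong:
  assumes "M \<ge> 1" "\<And>i. i \<in> {L..R} \<Longrightarrow> B i = A i" "inj_on A {L..R}"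
  shows "snd (quicksort M B L R) = snd (quicksort M A L R)"
  using quicksort_count_shift[of M L R 0 id A B] assms by (simp add: shifted_def strict_mono_on_def)

text \<open>All counts refer to the array left by the partitioning step rather than to those handed
  from call to call, so that each can be averaged separately.\<close>

lemma quicksort_count_rec:
  assumes M: "M \<ge> 1" and "\<not> R - L < int M" and inj: "inj_on A {L..R}"
    and step: "partition_step A L R = (A0, l, g, c0)"
  shows "snd (quicksort M A L R) = c0 + snd (quicksort M A0 L (l - 1)) +
    snd (quicksort M A0 (l + 1) (g - 1)) + snd (quicksort M A0 (g + 1) R)"
proof -
  have "L < R" using assms(1,2) by linarith
  note spec = partition_step_correct[OF step inj \<open>L < R\<close>]
  note b = spec(2-4)
  obtain \<sigma> where \<sigma>: "\<sigma> permutes {L..R}" "A0 = A \<circ> \<sigma>" using spec(1) by blast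
  note inj0 = comp_permutes_properties(3)[OF \<sigma> inj]
  obtain A1 c1 where q1: "quicksort M A0 L (l - 1) = (A1, c1)" by force
  obtain A2 c2 where q2: "quicksort M A1 (l + 1) (g - 1) = (A2, c2)" by force
  obtain A3 c3 where q3: "quicksort M A2 (g + 1) R = (A3, c3)" by force
  have A1: "A1 i = A0 i" if "i \<notin> {L..l - 1}" for i
    using quicksort_outside[OF inj_on_subset[OF inj0] M that] q1 b by force
  have inj1: "inj_on A1 {l + 1..g - 1}"
    by (rule inj_on_eq_subset[OF inj0]) (use A1 b in auto)
  have A2: "A2 i = A1 i" if "i \<notin> {l + 1..g - 1}" for i
    using quicksort_outside[OF inj1 M that] q2 by simp
  have "c2 = snd (quicksort M A0 (l + 1) (g - 1))"
    using quicksort_count_cong[OF M, of "l + 1" "g - 1" A1 A0] A1 q2 inj_on_subset[OF inj0, of "{l + 1..g - 1}"] b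
    by auto
  moreover have "c3 = snd (quicksort M A0 (g + 1) R)"
    using quicksort_count_cong[OF M, of "g + 1" R A2 A0] A1 A2 q3 inj_on_subset[OF inj0, of "{g + 1..R}"] b
    by auto
  ultimately show ?thesis
    using assms(2) step q1 q2 q3 by (subst quicksort.simps) simp
qed

subsection \<open>Uniformity of the subarrays\<close>

lemma partition_step_permutation:
  fixes \<pi> :: "int \<Rightarrow> int" and n :: nat
  defines "p \<equiv> min (\<pi> 1) (\<pi> (int n))" and "q \<equiv> max (\<pi> 1) (\<pi> (int n))"
  assumes \<pi>: "\<pi> permutes {1..int n}" and "n \<ge> 2"
  obtains A where "partition_step \<pi> 1 (int n) = (A, p, q, 1 + partition_cost \<pi> p q (q - 1) 2 (int n - 1))"
    "inj_on A {1..int n}" "1 \<le> p" "p < q" "q \<le> int n"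
    "A ` {1..p - 1} = {1..p - 1}" "A ` {p + 1..q - 1} = {p + 1..q - 1}"
    "A ` {q + 1..int n} = {q + 1..int n}"
proof -
  obtain A l g c where step: "partition_step \<pi> 1 (int n) = (A, l, g, c)" by (metis prod_cases4)
  have inj: "inj_on \<pi> {1..int n}" using \<pi> by (rule permutes_inj_on)
  have "1 < int n" using assms(4) by simp
  note spec = partition_step_correct[OF step inj this, folded p_def q_def]
  note b = spec(2-4)
  obtain \<sigma> where \<sigma>: "\<sigma> permutes {1..int n}" "A = \<pi> \<circ> \<sigma>" using spec(1) by blast
  have injA: "inj_on A {1..int n}" by (rule comp_permutes_properties(3)[OF \<sigma> inj])
  have A: "A permutes {1..int n}" using \<sigma> \<pi> by (simp add: permutes_compose)
  have A_in: "A i \<in> {1..int n}" if "i \<in> {1..int n}" for i using that permutes_in_image[OF A] by blast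
  have pq: "p \<in> {1..int n}" "q \<in> {1..int n}" "p < q"
  proof -
    show "p \<in> {1..int n}" "q \<in> {1..int n}" using A_in[of l] A_in[of g] b spec(5,6) by auto
    show "p < q" using inj_onD[OF inj, of 1 "int n"] \<open>n \<ge> 2\<close> by (force simp: p_def q_def min_def max_def)
  qed
  have card_le: "card S \<le> card T" if "A ` S \<subseteq> T" "S \<subseteq> {1..int n}" "finite T" for S T :: "int set"
    using card_inj_on_le[OF inj_on_subset[OF injA that(2)] that(1,3)] .
  \<comment> \<open>Comparing the number of positions with the number of available keys on both
    sides of each pivot pins its final position to its value.\<close>
  have "card {1..<l} \<le> card {1..<p}" "card {l<..int n} \<le> card {p<..int n}"
    "card {1..<g} \<le> card {1..<q}" "card {g<..int n} \<le> card {q<..int n}"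
  proof -
    show "card {1..<l} \<le> card {1..<p}" using spec(7) A_in b by (intro card_le) auto
    show "card {g<..int n} \<le> card {q<..int n}" using spec(9) A_in b by (intro card_le) auto
    have "p < A i" if i: "i \<in> {l<..int n}" for i
    proof -
      consider "i \<in> {l<..<g}" | "i = g" | "i \<in> {g<..int n}" using i by force
      then show ?thesis using spec(6) bspec[OF spec(8), of i] bspec[OF spec(9), of i] pq(3)
        by cases auto
    qed
    then show "card {l<..int n} \<le> card {p<..int n}" using A_in b by (intro card_le) auto
    have "A i < q" if i: "i \<in> {1..<g}" for i
    proof -
      consider "i \<in> {1..<l}" | "i = l" | "i \<in> {l<..<g}" using i by force
      then show ?thesis using spec(5) bspec[OF spec(7), of i] bspec[OF spec(8), of i] pq(3)
        by cases auto
    qed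
    then show "card {1..<g} \<le> card {1..<q}" using A_in b by (intro card_le) auto
  qed
  then have lg: "l = p" "g = q" using b pq by auto
  have img: "A ` S = S" if "A ` S \<subseteq> S" "S \<subseteq> {1..int n}" for S
    using endo_inj_surj[OF finite_subset[OF that(2)] that(1) inj_on_subset[OF injA that(2)]] by simp
  have bounds: "1 \<le> A i \<and> A i \<le> int n" if "1 \<le> i" "i \<le> int n" for i using A_in[of i] that by auto
  have "A i \<in> {1..p - 1}" if "i \<in> {1..p - 1}" for i
    using bspec[OF spec(7), of i] bounds[of i] that pq(2,3) lg by auto
  then have "A ` {1..p - 1} = {1..p - 1}" using pq(1) by (intro img) auto
  moreover have "A i \<in> {p + 1..q - 1}" if "i \<in> {p + 1..q - 1}" for i
    using bspec[OF spec(8), of i] that lg by auto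
  then have "A ` {p + 1..q - 1} = {p + 1..q - 1}" using pq by (intro img) auto
  moreover have "A i \<in> {q + 1..int n}" if "i \<in> {q + 1..int n}" for i
    using bspec[OF spec(9), of i] bounds[of i] that pq(2) lg by auto
  then have "A ` {q + 1..int n} = {q + 1..int n}" using pq(2) by (intro img) auto
  \<comment> \<open>The pivots are not large, so the inner positions hold all \<open>n - q\<close>
    large keys, and the meeting point is \<open>n - 1 - (n - q) = q - 1\<close>.\<close>
  moreover have "card {i\<in>{1 + 1..int n - 1}. q < \<pi> i} = card {q<..int n}"
  proof -
    have e1: "{i\<in>{1 + 1..int n - 1}. q < \<pi> i} = {i\<in>{1..int n}. q < \<pi> i}"
    proof (rule set_eqI)
      fix i
      have "\<pi> 1 \<le> q" "\<pi> (int n) \<le> q" by (auto simp: q_def)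
      then show "i \<in> {i\<in>{1 + 1..int n - 1}. q < \<pi> i} \<longleftrightarrow> i \<in> {i\<in>{1..int n}. q < \<pi> i}"
        by (cases "i = 1"; cases "i = int n") auto
    qed
    have e2: "card (\<pi> ` {i\<in>{1..int n}. q < \<pi> i}) = card {i\<in>{1..int n}. q < \<pi> i}"
      by (rule card_image, rule inj_on_subset[OF inj]) auto
    have e3: "\<pi> ` {i\<in>{1..int n}. q < \<pi> i} = {q<..int n}"
    proof -
      have "\<pi> ` {i\<in>{1..int n}. q < \<pi> i} = {x \<in> \<pi> ` {1..int n}. q < x}" by auto
      also have "\<dots> = {q<..int n}" using pq(2) unfolding permutes_image[OF \<pi>] by auto
      finally show ?thesis .
    qed
    show ?thesis unfolding e1 e2[symmetric] e3 ..
  qed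
  then have "c = 1 + partition_cost \<pi> p q (q - 1) 2 (int n - 1)" using spec(10) pq(2) by simp
  ultimately show ?thesis using that[of A] step lg injA pq by auto
qed

text \<open>After partitioning, positions \<open>s + 1..s + m\<close> hold exactly the keys
  \<open>s + 1..s + m\<close>, so one offset serves for positions and keys. The identity outside is
  what \<open>permutes\<close> demands.\<close>

definition block :: "(int \<Rightarrow> int) \<Rightarrow> int \<Rightarrow> nat \<Rightarrow> int \<Rightarrow> int" where
  "block A s m i = (if i \<in> {1..int m} then A (i + s) - s else i)"

lemma shift_image_int: "(\<lambda>i. i + s) ` {1..int m} = {s + 1..s + int m}"
  using image_add_atLeastAtMost[of s 1 "int m"] by (simp add: add.commute)

lemma quicksort_block:
  assumes "M \<ge> 1" "inj_on A {s + 1..s + int m}"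
  shows "snd (quicksort M A (s + 1) (s + int m)) = key_comparisons M m (block A s m)"
proof -
  have "inj_on (block A s m) {1..int m}"
  proof (rule inj_onI)
    fix i j assume "i \<in> {1..int m}" "j \<in> {1..int m}" "block A s m i = block A s m j"
    then show "i = j" using inj_onD[OF assms(2), of "i + s" "j + s"] by (auto simp: block_def)
  qed
  then show ?thesis
    using quicksort_count_shift[OF assms(1), of 1 "int m" s "\<lambda>x. x + s" "block A s m" A]
    by (simp add: key_comparisons_def shifted_def block_def strict_mono_on_def add.commute)
qed

lemma block_permutes:
  assumes "inj_on A {s + 1..s + int m}" "A ` {s + 1..s + int m} = {s + 1..s + int m}"
  shows "block A s m permutes {1..int m}"
proof (rule bij_imp_permutes)
  have "block A s m ` {1..int m} = (\<lambda>i. A (i + s) - s) ` {1..int m}"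
    by (rule image_cong) (auto simp: block_def)
  also have "\<dots> = (\<lambda>x. x - s) ` A ` (\<lambda>i. i + s) ` {1..int m}" by (simp only: image_image)
  also have "\<dots> = (\<lambda>x. x - s) ` (\<lambda>i. i + s) ` {1..int m}"
    unfolding shift_image_int assms(2) ..
  also have "\<dots> = {1..int m}" by (simp add: image_image)
  finally show "bij_betw (block A s m) {1..int m} {1..int m}"
    by (simp add: bij_betw_def finite_surj_inj)
  show "\<And>i. i \<notin> {1..int m} \<Longrightarrow> block A s m i = i" by (auto simp: block_def)
qed

definition lift_block :: "int \<Rightarrow> nat \<Rightarrow> (int \<Rightarrow> int) \<Rightarrow> int \<Rightarrow> int" where
  "lift_block s m \<tau> x = (if x \<in> {s + 1..s + int m} then \<tau> (x - s) + s else x)"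

lemma lift_block_permutes:
  assumes "\<tau> permutes {1..int m}"
  shows "lift_block s m \<tau> permutes {s + 1..s + int m}"
proof (rule bij_imp_permutes)
  have "lift_block s m \<tau> ` {s + 1..s + int m} = (\<lambda>x. \<tau> (x - s) + s) ` {s + 1..s + int m}"
    by (rule image_cong) (auto simp: lift_block_def)
  also have "\<dots> = (\<lambda>x. x + s) ` \<tau> ` (\<lambda>x. x - s) ` {s + 1..s + int m}" by (simp only: image_image)
  also have "(\<lambda>x. x - s) ` {s + 1..s + int m} = {1..int m}"
    unfolding shift_image_int[symmetric] by (simp add: image_image)
  also have "(\<lambda>x. x + s) ` \<tau> ` {1..int m} = {s + 1..s + int m}"
    unfolding permutes_image[OF assms] shift_image_int ..
  finally show "bij_betw (lift_block s m \<tau>) {s + 1..s + int m} {s + 1..s + int m}"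
    by (simp add: bij_betw_def finite_surj_inj)
  show "\<And>x. x \<notin> {s + 1..s + int m} \<Longrightarrow> lift_block s m \<tau> x = x" by (auto simp: lift_block_def)
qed

text \<open>No key crosses \<open>p\<close>: keys in \<open>S\<close> stay in \<open>S\<close>,
  which lies on one side of \<open>p\<close>, and all others are fixed.\<close>

lemma order_compat_permutes:
  fixes \<tau> :: "int \<Rightarrow> int"
  assumes "\<tau> permutes S" "(\<forall>x\<in>S. x < p) \<or> (\<forall>x\<in>S. p < x)"
  shows "order_compat \<tau> T p"
proof -
  have "p \<notin> S" using assms(2) by auto
  then have p: "\<tau> p = p" using assms(1) by (simp add: permutes_def)
  have "\<tau> x = x \<or> x \<in> S \<and> \<tau> x \<in> S" for x
    using assms(1) permutes_in_image[OF assms(1), of x] by (auto simp: permutes_def)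
  then show ?thesis using assms(2) p unfolding order_compat_def by (metis less_asym)
qed

text \<open>
  For every permutation \<open>\<tau>\<close> of the block, \<open>\<pi> \<mapsto> lift_block s m \<tau> \<circ> \<pi>\<close> permutes the inputs with the
  given pivots and composes the resulting block with \<open>\<tau>\<close>; summing over \<open>\<tau>\<close> makes the block uniform.
\<close>

lemma sum_block_average:
  fixes F :: "(int \<Rightarrow> int) \<Rightarrow> real" and n m :: nat and a b s :: int
  defines "X \<equiv> {\<pi>. \<pi> permutes {1..int n} \<and> \<pi> 1 = a \<and> \<pi> (int n) = b}"
    and "p \<equiv> min a b" and "q \<equiv> max a b"
  assumes "n \<ge> 2"
    and sm: "s = 0 \<and> int m = p - 1 \<or> s = p \<and> int m = q - p - 1 \<or> s = q \<and> int m = int n - q"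
  shows "(\<Sum>\<pi>\<in>X. F (block (fst (partition_step \<pi> 1 (int n))) s m)) =
    (\<Sum>\<pi>\<in>X. (\<Sum>\<tau> | \<tau> permutes {1..int m}. F \<tau>) / fact m)"
proof -
  define part where "part \<pi> = fst (partition_step \<pi> 1 (int n))" for \<pi> :: "int \<Rightarrow> int"
  have step: "\<exists>c. partition_step \<pi> 1 (int n) = (part \<pi>, p, q, c)" "inj_on (part \<pi>) {1..int n}"
    "1 \<le> p" "p < q" "q \<le> int n" "part \<pi> ` {s + 1..s + int m} = {s + 1..s + int m}" if "\<pi> \<in> X" for \<pi>
  proof -
    have \<pi>: "\<pi> permutes {1..int n}" "min (\<pi> 1) (\<pi> (int n)) = p" "max (\<pi> 1) (\<pi> (int n)) = q"
      using that by (auto simp: X_def p_def q_def)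
    obtain A c where A: "partition_step \<pi> 1 (int n) = (A, p, q, c)"
      "inj_on A {1..int n}" "1 \<le> p" "p < q" "q \<le> int n" "A ` {1..p - 1} = {1..p - 1}"
      "A ` {p + 1..q - 1} = {p + 1..q - 1}" "A ` {q + 1..int n} = {q + 1..int n}"
      using partition_step_permutation[OF \<pi>(1) \<open>n \<ge> 2\<close>, unfolded \<pi>(2,3)] by metis
    have "part \<pi> = A" using A(1) by (simp add: part_def)
    moreover have "A ` {s + 1..s + int m} = {s + 1..s + int m}" using sm A(6-8) by auto
    ultimately show "\<exists>c. partition_step \<pi> 1 (int n) = (part \<pi>, p, q, c)" "inj_on (part \<pi>) {1..int n}"
    "1 \<le> p" "p < q" "q \<le> int n" "part \<pi> ` {s + 1..s + int m} = {s + 1..s + int m}"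
      using A(1-5) by auto
  qed
  have perm: "block (part \<pi>) s m permutes {1..int m}" if "\<pi> \<in> X" for \<pi>
    using step[OF that] sm by (intro block_permutes) (auto intro: inj_on_subset)
  have sub: "{s + 1..s + int m} \<subseteq> {1..int n}" if "\<pi> \<in> X" for \<pi> using step(3-5)[OF that] sm by auto
  have relabel: "(\<Sum>\<pi>\<in>X. F (block (part \<pi>) s m)) = (\<Sum>\<pi>\<in>X. F (\<tau> \<circ> block (part \<pi>) s m))"
    if \<tau>: "\<tau> permutes {1..int m}" for \<tau>
  proof -
    let ?t = "lift_block s m \<tau>"
    note t = lift_block_permutes[OF \<tau>, of s]
    have fix_pivots: "?t a = a \<and> ?t b = b"
      using sm by (auto simp: lift_block_def p_def q_def)
    have X_mem: "f \<circ> \<pi> \<in> X" if "\<pi> \<in> X" "f permutes {s + 1..s + int m}" "f a = a" "f b = b" for f \<pi>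
      using that permutes_compose[OF _ permutes_subset[OF that(2) sub[OF that(1)]], of \<pi>]
      by (auto simp: X_def)
    have inv_fix: "inv ?t a = a \<and> inv ?t b = b"
      using fix_pivots permutes_inverses[OF t] by metis
    have comm: "block (part (?t \<circ> \<pi>)) s m = \<tau> \<circ> block (part \<pi>) s m" if \<pi>: "\<pi> \<in> X" for \<pi>
    proof -
      obtain c where c: "partition_step \<pi> 1 (int n) = (part \<pi>, p, q, c)" using step(1)[OF \<pi>] by blast
      have "\<pi> 1 \<in> {p, q}" "\<pi> (int n) \<in> {p, q}" using \<pi> by (auto simp: X_def p_def q_def)
      moreover have "order_compat ?t (\<pi> ` {1..int n}) x" if "x \<in> {p, q}" for x
        by (rule order_compat_permutes[OF t]) (use that sm step(3-5)[OF \<pi>] in auto)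
      ultimately obtain B where B: "partition_step (?t \<circ> \<pi>) 1 (int n) = (B, p, q, c)"
        "shifted 1 (int n) 0 ?t (part \<pi>) B"
        using partition_step_shift[OF c, of 0 ?t "?t \<circ> \<pi>"] \<open>n \<ge> 2\<close> \<pi>
        by (auto simp: X_def shifted_def permutes_inj_on)
      then have "part (?t \<circ> \<pi>) = B" by (simp add: part_def)
      moreover have "B (i + s) = ?t (part \<pi> (i + s))" if "i \<in> {1..int m}" for i
        using B(2) sub[OF \<pi>] that by (auto simp: shifted_def)
      moreover have "part \<pi> (i + s) \<in> {s + 1..s + int m}" if "i \<in> {1..int m}" for i
        using step(6)[OF \<pi>] that by auto
      ultimately show ?thesis using \<tau> by (auto simp: block_def lift_block_def fun_eq_iff permutes_def)
    qed
    have "(\<Sum>\<pi>\<in>X. F (block (part \<pi>) s m)) = (\<Sum>\<pi>\<in>X. F (block (part (?t \<circ> \<pi>)) s m))"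
      by (rule sum.reindex_bij_witness[of _ "\<lambda>\<pi>. ?t \<circ> \<pi>" "\<lambda>\<pi>. inv ?t \<circ> \<pi>"])
        (use X_mem t permutes_inv[OF t] fix_pivots inv_fix permutes_inv_o[OF t] in
          \<open>auto simp: comp_assoc[symmetric]\<close>)
    then show ?thesis using comm by simp
  qed
  let ?P = "{\<tau>. \<tau> permutes {1..int m}}"
  have card: "card ?P = fact m" using card_permutations[of "{1..int m}" m] by simp
  have "fact m * (\<Sum>\<pi>\<in>X. F (block (part \<pi>) s m)) = (\<Sum>\<tau>\<in>?P. \<Sum>\<pi>\<in>X. F (block (part \<pi>) s m))"
    by (simp add: card)
  also have "\<dots> = (\<Sum>\<tau>\<in>?P. \<Sum>\<pi>\<in>X. F (\<tau> \<circ> block (part \<pi>) s m))"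
    by (intro sum.cong refl relabel) simp
  also have "\<dots> = (\<Sum>\<pi>\<in>X. \<Sum>\<tau>\<in>?P. F (\<tau> \<circ> block (part \<pi>) s m))" by (rule sum.swap)
  also have "\<dots> = (\<Sum>\<pi>\<in>X. \<Sum>\<tau>\<in>?P. F \<tau>)"
    by (intro sum.cong refl sum_permutations_compose_right[symmetric] perm)
  finally show ?thesis by (simp add: part_def field_simps sum_divide_distrib[symmetric])
qed

subsection \<open>Exchangeability of positions\<close>

lemma expected_comparisons_eq:
  "expected_comparisons M n = (\<Sum>\<pi> | \<pi> permutes {1..int n}. real (key_comparisons M n \<pi>)) / fact n"
proof -
  have "{\<pi>. \<pi> permutes {1..int n}} \<noteq> {}" using permutes_id by blast
  then show ?thesis
    unfolding expected_comparisons_def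
    by (subst integral_pmf_of_set)
       (simp_all add: finite_permutations card_permutations[of "{1..int n}" n])
qed

lemma card_permutes_int: "card {\<pi>. \<pi> permutes {1..int n}} = fact n"
  using card_permutations[of "{1..int n}" n] by simp

lemma sum_permutes_transpose:
  fixes f :: "(int \<Rightarrow> int) \<Rightarrow> real"
  assumes "i \<in> {1..int n}" "j \<in> {1..int n}"
  shows "(\<Sum>\<pi> | \<pi> permutes {1..int n}. f \<pi>) =
    (\<Sum>\<pi> | \<pi> permutes {1..int n}. f (\<pi> \<circ> Transposition.transpose i j))"
  by (rule sum_permutations_compose_right) (rule permutes_swap_id[OF assms])

text \<open>\<open>H\<close> may depend on \<open>\<pi>\<close> through anything that swapping
  \<open>i\<close> with another position of \<open>J\<close> leaves alone, such as the pivots or the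
  minimum of a prefix. Then \<open>i\<close> is as good as any other position of
  \<open>J\<close>.\<close>

lemma sum_permutes_exchange:
  fixes H :: "(int \<Rightarrow> int) \<Rightarrow> int \<Rightarrow> real"
  assumes "J \<subseteq> {1..int n}" "i \<in> J"
    and "\<And>\<pi> j x. \<pi> permutes {1..int n} \<Longrightarrow> j \<in> J \<Longrightarrow> H (\<pi> \<circ> Transposition.transpose i j) x = H \<pi> x"
  shows "card J * (\<Sum>\<pi> | \<pi> permutes {1..int n}. H \<pi> (\<pi> i)) =
    (\<Sum>\<pi> | \<pi> permutes {1..int n}. \<Sum>x\<in>\<pi> ` J. H \<pi> x)"
proof -
  let ?P = "{\<pi>. \<pi> permutes {1..int n}}"
  have "card J * (\<Sum>\<pi>\<in>?P. H \<pi> (\<pi> i)) = (\<Sum>j\<in>J. \<Sum>\<pi>\<in>?P. H \<pi> (\<pi> i))" by simp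
  also have "\<dots> = (\<Sum>j\<in>J. \<Sum>\<pi>\<in>?P. H \<pi> (\<pi> j))"
  proof (rule sum.cong[OF refl])
    fix j assume j: "j \<in> J"
    have "(\<Sum>\<pi>\<in>?P. H \<pi> (\<pi> i)) = (\<Sum>\<pi>\<in>?P. H (\<pi> \<circ> Transposition.transpose i j) ((\<pi> \<circ> Transposition.transpose i j) i))"
      by (rule sum_permutes_transpose) (use assms(1,2) j in auto)
    also have "\<dots> = (\<Sum>\<pi>\<in>?P. H \<pi> (\<pi> j))"
      using assms(3) j by (intro sum.cong) auto
    finally show "(\<Sum>\<pi>\<in>?P. H \<pi> (\<pi> i)) = (\<Sum>\<pi>\<in>?P. H \<pi> (\<pi> j))" .
  qed
  also have "\<dots> = (\<Sum>\<pi>\<in>?P. \<Sum>j\<in>J. H \<pi> (\<pi> j))" by (rule sum.swap)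
  also have "\<dots> = (\<Sum>\<pi>\<in>?P. \<Sum>x\<in>\<pi> ` J. H \<pi> x)"
    by (rule sum.cong[OF refl]) (simp add: sum.reindex[OF permutes_inj_on])
  finally show ?thesis .
qed

lemma permutes_image_Diff:
  assumes "\<pi> permutes S" "T \<subseteq> S"
  shows "\<pi> ` (S - T) = S - \<pi> ` T"
  using image_set_diff[OF permutes_inj[OF assms(1)]] permutes_image[OF assms(1)] by simp

text \<open>Two exchanges: position \<open>n\<close> against all but the first with
  \<open>\<pi> 1\<close> held fixed, then position 1 against all.\<close>

lemma sum_permutes_endpoints:
  fixes G :: "int \<Rightarrow> int \<Rightarrow> real"
  assumes "n \<ge> 2"
  shows "real n * real (n - 1) * (\<Sum>\<pi> | \<pi> permutes {1..int n}. G (\<pi> 1) (\<pi> (int n))) =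
    fact n * (\<Sum>a\<in>{1..int n}. \<Sum>b\<in>{1..int n} - {a}. G a b)"
proof -
  let ?P = "{\<pi>. \<pi> permutes {1..int n}}"
  have "{1..int n} - {1} = {2..int n}" by auto
  then have card: "card ({1..int n} - {1}) = n - 1" by simp
  have "real (card ({1..int n} - {1})) * (\<Sum>\<pi>\<in>?P. G (\<pi> 1) (\<pi> (int n))) =
      (\<Sum>\<pi>\<in>?P. \<Sum>x\<in>\<pi> ` ({1..int n} - {1}). G (\<pi> 1) x)"
    by (rule sum_permutes_exchange) (use assms in \<open>auto simp: Transposition.transpose_def\<close>)
  also have "\<dots> = (\<Sum>\<pi>\<in>?P. \<Sum>x\<in>{1..int n} - {\<pi> 1}. G (\<pi> 1) x)"
    using assms by (intro sum.cong refl) (auto simp: permutes_image_Diff)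
  also have "real (card {1..int n}) * \<dots> = (\<Sum>\<pi>\<in>?P. \<Sum>a\<in>\<pi> ` {1..int n}. \<Sum>x\<in>{1..int n} - {a}. G a x)"
    by (rule sum_permutes_exchange) (use assms in auto)
  also have "\<dots> = (\<Sum>\<pi>\<in>?P. \<Sum>a\<in>{1..int n}. \<Sum>x\<in>{1..int n} - {a}. G a x)"
    by (intro sum.cong refl) (auto simp: permutes_image)
  also have "\<dots> = fact n * (\<Sum>a\<in>{1..int n}. \<Sum>x\<in>{1..int n} - {a}. G a x)"
    by (simp add: card_permutes_int)
  finally show ?thesis unfolding card by (simp add: mult.assoc)
qed

lemma sum_distinct_pairs:
  fixes S :: "int \<Rightarrow> int \<Rightarrow> real"
  shows "(\<Sum>a\<in>{1..int n}. \<Sum>b\<in>{1..int n} - {a}. S (min a b) (max a b)) =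
    2 * (\<Sum>q\<in>{1..int n}. \<Sum>p\<in>{1..<q}. S p q)"
proof -
  have "(\<Sum>b\<in>{1..int n} - {a}. S (min a b) (max a b)) =
      (\<Sum>b\<in>{1..<a}. S b a) + (\<Sum>b | b \<in> {1..int n} \<and> a \<in> {1..<b}. S a b)" if "a \<in> {1..int n}" for a
  proof -
    have split: "{1..int n} - {a} = {1..<a} \<union> {b. b \<in> {1..int n} \<and> a \<in> {1..<b}}" using that by auto
    have "finite {b. b \<in> {1..int n} \<and> a \<in> {1..<b}}" by (rule finite_subset[of _ "{1..int n}"]) auto
    then have "(\<Sum>b\<in>{1..int n} - {a}. S (min a b) (max a b)) = (\<Sum>b\<in>{1..<a}. S (min a b) (max a b)) +
        (\<Sum>b | b \<in> {1..int n} \<and> a \<in> {1..<b}. S (min a b) (max a b))"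
      unfolding split by (subst sum.union_disjoint) auto
    then show ?thesis by simp
  qed
  then have "(\<Sum>a\<in>{1..int n}. \<Sum>b\<in>{1..int n} - {a}. S (min a b) (max a b)) =
      (\<Sum>a\<in>{1..int n}. \<Sum>b\<in>{1..<a}. S b a) +
      (\<Sum>a\<in>{1..int n}. \<Sum>b | b \<in> {1..int n} \<and> a \<in> {1..<b}. S a b)"
    by (simp add: sum.distrib)
  also have "(\<Sum>a\<in>{1..int n}. \<Sum>b | b \<in> {1..int n} \<and> a \<in> {1..<b}. S a b) =
      (\<Sum>b\<in>{1..int n}. \<Sum>a | a \<in> {1..int n} \<and> a \<in> {1..<b}. S a b)"
    by (rule sum.swap_restrict) auto
  also have "\<dots> = (\<Sum>b\<in>{1..int n}. \<Sum>a\<in>{1..<b}. S a b)"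
    by (intro sum.cong refl) auto
  finally show ?thesis by simp
qed

lemma sum_permutes_inversion:
  assumes "i \<in> {1..int n}" "j \<in> {1..int n}" "i \<noteq> j"
  shows "(\<Sum>\<pi> | \<pi> permutes {1..int n}. of_bool (\<pi> i < \<pi> j)) = (fact n / 2 :: real)"
proof -
  let ?P = "{\<pi>. \<pi> permutes {1..int n}}"
  have "(\<Sum>\<pi>\<in>?P. of_bool (\<pi> i < \<pi> j)) = (\<Sum>\<pi>\<in>?P. of_bool (\<pi> j < \<pi> i) :: real)"
    by (subst sum_permutes_transpose[OF assms(1,2)]) simp
  then have "2 * (\<Sum>\<pi>\<in>?P. of_bool (\<pi> i < \<pi> j)) =
      (\<Sum>\<pi>\<in>?P. of_bool (\<pi> i < \<pi> j) + of_bool (\<pi> j < \<pi> i) :: real)"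
    by (simp add: sum.distrib)
  also have "\<dots> = (\<Sum>\<pi>\<in>?P. 1)"
  proof (intro sum.cong refl)
    fix \<pi> assume "\<pi> \<in> ?P"
    then have "\<pi> i \<noteq> \<pi> j" using permutes_inj assms(3) by (auto dest: injD)
    then show "of_bool (\<pi> i < \<pi> j) + of_bool (\<pi> j < \<pi> i) = (1 :: real)" by auto
  qed
  also have "\<dots> = fact n" by (simp add: card_permutes_int)
  finally show ?thesis by simp
qed

text \<open>By exchangeability within \<open>{1..i}\<close>, position \<open>i\<close> holds the
  minimum of the first \<open>i\<close> keys with probability \<open>1 / i\<close>.\<close>

lemma sum_permutes_not_record:
  assumes "i \<in> {1..int n}"
  shows "(\<Sum>\<pi> | \<pi> permutes {1..int n}. of_bool (\<exists>j\<in>{1..<i}. \<pi> j < \<pi> i)) = (fact n * (1 - 1 / real_of_int i) :: real)"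
proof -
  let ?P = "{\<pi>. \<pi> permutes {1..int n}}"
  have img: "(\<pi> \<circ> Transposition.transpose i j) ` {1..i} = \<pi> ` {1..i}" if "j \<in> {1..i}" for \<pi> :: "int \<Rightarrow> int" and j
    using that unfolding image_comp[symmetric] by simp
  have "real (card {1..i}) * (\<Sum>\<pi>\<in>?P. of_bool (\<pi> i = Min (\<pi> ` {1..i}))) =
      (\<Sum>\<pi>\<in>?P. \<Sum>x\<in>\<pi> ` {1..i}. of_bool (x = Min (\<pi> ` {1..i})))"
    by (rule sum_permutes_exchange) (use assms img in auto)
  also have "\<dots> = (\<Sum>\<pi>\<in>?P. 1)"
    using assms by (intro sum.cong refl) (auto simp: sum.If_cases of_bool_def Int_absorb1)
  also have "\<dots> = fact n" by (simp add: card_permutes_int)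
  finally have *: "real_of_int i * (\<Sum>\<pi>\<in>?P. of_bool (\<pi> i = Min (\<pi> ` {1..i}))) = fact n" using assms by simp
  have "(\<Sum>\<pi>\<in>?P. of_bool (\<exists>j\<in>{1..<i}. \<pi> j < \<pi> i)) = (\<Sum>\<pi>\<in>?P. 1 - of_bool (\<pi> i = Min (\<pi> ` {1..i})) :: real)"
  proof (intro sum.cong refl)
    fix \<pi> assume "\<pi> \<in> ?P"
    have "(\<exists>j\<in>{1..<i}. \<pi> j < \<pi> i) \<longleftrightarrow> \<not> (\<forall>j\<in>{1..i}. \<pi> i \<le> \<pi> j)"
    proof
      assume "\<not> (\<forall>j\<in>{1..i}. \<pi> i \<le> \<pi> j)"
      then obtain j where "j \<in> {1..i}" "\<pi> j < \<pi> i" by (auto simp: not_le)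
      then show "\<exists>j\<in>{1..<i}. \<pi> j < \<pi> i" by (intro bexI[of _ j]) (auto simp: order_less_le)
    qed force
    also have "(\<forall>j\<in>{1..i}. \<pi> i \<le> \<pi> j) \<longleftrightarrow> \<pi> i = Min (\<pi> ` {1..i})"
      using assms by (subst eq_Min_iff) auto
    finally show "of_bool (\<exists>j\<in>{1..<i}. \<pi> j < \<pi> i) = (1 - of_bool (\<pi> i = Min (\<pi> ` {1..i})) :: real)" by simp
  qed
  also have "\<dots> = fact n - fact n / real_of_int i"
    using * assms by (simp add: sum_subtractf card_permutes_int field_simps)
  finally show ?thesis by (simp add: algebra_simps)
qed

lemma sum_int_interval: "(\<Sum>i\<in>{1..int n}. f i) = (\<Sum>i<n. f (int i + 1))"
proof -
  have "{1..int n} = (\<lambda>i. int i + 1) ` {..<n}"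
  proof (intro set_eqI iffI)
    fix x assume "x \<in> {1..int n}"
    then show "x \<in> (\<lambda>i. int i + 1) ` {..<n}" by (intro image_eqI[of _ _ "nat (x - 1)"]) auto
  qed auto
  then show ?thesis by (simp add: sum.reindex inj_on_def)
qed

text \<open>\<open>n * (n - 1) / 4\<close> is the expected number of inversions,
  \<open>n - harm n\<close> that of positions which are not left-to-right minima.\<close>

lemma expected_insertion:
  assumes "n \<le> M"
  shows "expected_comparisons M n = real n * (real n - 1) / 4 + real n - harm n"
proof -
  let ?P = "{\<pi>. \<pi> permutes {1..int n}}"
  have count: "real (key_comparisons M n \<pi>) = (\<Sum>i\<in>{1<..int n}.
      (\<Sum>j\<in>{1..<i}. of_bool (\<pi> i < \<pi> j)) + of_bool (\<exists>j\<in>{1..<i}. \<pi> j < \<pi> i))" if "\<pi> \<in> ?P" for \<pi>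
  proof -
    obtain A c where A: "insertion_sort \<pi> 1 (int n) = (A, c)" by force
    have "c = insertion_cost \<pi> 1 (int n)"
      using insertion_sort_correct(2)[OF A] that by (simp add: permutes_inj_on)
    moreover have "key_comparisons M n \<pi> = c"
      using assms A unfolding key_comparisons_def by (subst quicksort.simps) simp
    moreover have "(\<Sum>j\<in>{1..<i}. of_bool (\<pi> i < \<pi> j)) = card {j\<in>{1..<i}. \<pi> i < \<pi> j}" for i
      by (simp add: sum.If_cases of_bool_def Int_def)
    ultimately show ?thesis by (simp add: insertion_cost_def)
  qed
  have "(\<Sum>\<pi>\<in>?P. real (key_comparisons M n \<pi>)) = (\<Sum>i\<in>{1<..int n}. \<Sum>\<pi>\<in>?P.
      (\<Sum>j\<in>{1..<i}. of_bool (\<pi> i < \<pi> j)) + of_bool (\<exists>j\<in>{1..<i}. \<pi> j < \<pi> i))"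
    by (subst sum.swap) (simp add: count)
  also have "\<dots> = (\<Sum>i\<in>{1<..int n}. fact n * ((real_of_int i - 1) / 2 + (1 - 1 / real_of_int i)))"
  proof (intro sum.cong refl)
    fix i assume i: "i \<in> {1<..int n}"
    have "(\<Sum>\<pi>\<in>?P. \<Sum>j\<in>{1..<i}. of_bool (\<pi> i < \<pi> j)) = (\<Sum>j\<in>{1..<i}. fact n / 2 :: real)"
      by (subst sum.swap, intro sum.cong refl sum_permutes_inversion) (use i in auto)
    also have "\<dots> = fact n * ((real_of_int i - 1) / 2)" using i by simp
    finally have 1: "(\<Sum>\<pi>\<in>?P. \<Sum>j\<in>{1..<i}. of_bool (\<pi> i < \<pi> j)) = fact n * ((real_of_int i - 1) / 2)" .
    have "i \<in> {1..int n}" using i by auto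
    note 2 = sum_permutes_not_record[OF this]
    show "(\<Sum>\<pi>\<in>?P. (\<Sum>j\<in>{1..<i}. of_bool (\<pi> i < \<pi> j)) + of_bool (\<exists>j\<in>{1..<i}. \<pi> j < \<pi> i)) =
      fact n * ((real_of_int i - 1) / 2 + (1 - 1 / real_of_int i))"
      by (simp only: sum.distrib 1 2 distrib_left)
  qed
  also have "\<dots> = (\<Sum>i\<in>{1..int n}. fact n * ((real_of_int i - 1) / 2 + (1 - 1 / real_of_int i)))"
  proof (rule sum.mono_neutral_left)
    show "\<forall>i\<in>{1..int n} - {1<..int n}. fact n * ((real_of_int i - 1) / 2 + (1 - 1 / real_of_int i)) = 0"
    proof
      fix i assume "i \<in> {1..int n} - {1<..int n}"
      then have "i = 1" by auto
      then show "fact n * ((real_of_int i - 1) / 2 + (1 - 1 / real_of_int i)) = 0" by simp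
    qed
  qed auto
  also have "\<dots> = fact n * (\<Sum>i<n. real i / 2 + (1 - 1 / (real i + 1)))"
    by (simp add: sum_int_interval sum_distrib_left)
  also have "(\<Sum>i<n. real i / 2 + (1 - 1 / (real i + 1))) = real n * (real n - 1) / 4 + real n - harm n"
  proof (induction n)
    case (Suc n)
    have "1 / (real n + 1) = inverse (real (Suc n))" by (simp add: inverse_eq_divide add.commute)
    then show ?case by (simp only: sum.lessThan_Suc Suc harm_Suc) (simp add: field_simps)
  qed (simp add: harm_expand)
  finally show ?thesis by (simp add: expected_comparisons_eq)
qed

subsection \<open>The expected cost of partitioning\<close>

lemma sum_permutes_fibres:
  fixes f g :: "(int \<Rightarrow> int) \<Rightarrow> real"
  assumes "n \<ge> 1" "\<And>a b. (\<Sum>\<pi> | \<pi> permutes {1..int n} \<and> \<pi> 1 = a \<and> \<pi> (int n) = b. f \<pi>) =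
    (\<Sum>\<pi> | \<pi> permutes {1..int n} \<and> \<pi> 1 = a \<and> \<pi> (int n) = b. g \<pi>)"
  shows "(\<Sum>\<pi> | \<pi> permutes {1..int n}. f \<pi>) = (\<Sum>\<pi> | \<pi> permutes {1..int n}. g \<pi>)"
proof -
  let ?P = "{\<pi>. \<pi> permutes {1..int n}}" and ?T = "{1..int n} \<times> {1..int n}"
  have mem: "(\<lambda>\<pi>. (\<pi> 1, \<pi> (int n))) ` ?P \<subseteq> ?T"
  proof (rule image_subsetI)
    fix \<pi> assume "\<pi> \<in> ?P"
    then have \<pi>: "\<pi> permutes {1..int n}" by simp
    show "(\<pi> 1, \<pi> (int n)) \<in> ?T"
      using permutes_in_image[OF \<pi>, of 1] permutes_in_image[OF \<pi>, of "int n"] assms(1) by simp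
  qed
  have fin: "finite ?P" "finite ?T" by (simp_all add: finite_permutations)
  have group: "(\<Sum>y\<in>?T. \<Sum>\<pi> | \<pi> permutes {1..int n} \<and> \<pi> 1 = fst y \<and> \<pi> (int n) = snd y. h \<pi>) = sum h ?P"
    for h :: "(int \<Rightarrow> int) \<Rightarrow> real"
    using sum.group[OF fin mem, of h] by (simp add: prod_eq_iff)
  show ?thesis unfolding group[symmetric] assms(2) ..
qed

text \<open>The surcharge is attached to position \<open>q\<close>. Each summand then depends on the
  pivots and one further key, as exchangeability requires.\<close>

lemma sum_partition_cost:
  fixes n :: nat and p q :: int
  assumes n: "n \<ge> 2" and q: "2 \<le> q" "q \<le> int n"
  shows "real (partition_cost \<pi> p q (q - 1) 2 (int n - 1)) =
    (\<Sum>i\<in>{2..int n - 1}. 1 + (if i < q then of_bool (p \<le> \<pi> i) else of_bool (\<pi> i \<le> q)) +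
      3 * of_bool (i = q \<and> q < \<pi> i))"
proof -
  have "(\<Sum>i\<in>{2..int n - 1}. 3 * of_bool (i = q \<and> q < \<pi> i)) =
      (\<Sum>i\<in>{2..int n - 1}. if i = q then 3 * of_bool (q < \<pi> q) else (0::real))"
    by (intro sum.cong) auto
  also have "\<dots> = real (3 * of_bool (2 \<le> q - 1 + 1 \<and> q - 1 + 1 \<le> int n - 1 \<and> q < \<pi> (q - 1 + 1)))"
    using q by auto
  finally have extra: "real (3 * of_bool (2 \<le> q - 1 + 1 \<and> q - 1 + 1 \<le> int n - 1 \<and> q < \<pi> (q - 1 + 1))) =
    (\<Sum>i\<in>{2..int n - 1}. 3 * of_bool (i = q \<and> q < \<pi> i) :: real)" ..
  have "real (\<Sum>i\<in>{2..int n - 1}. 1 + (if i \<le> q - 1 then of_bool (p \<le> \<pi> i) else of_bool (\<pi> i \<le> q))) =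
    (\<Sum>i\<in>{2..int n - 1}. 1 + (if i < q then of_bool (p \<le> \<pi> i) else of_bool (\<pi> i \<le> q)))"
    unfolding of_nat_sum by (rule sum.cong) auto
  then show ?thesis unfolding partition_cost_def of_nat_add extra by (simp only: sum.distrib)
qed

text \<open>For given pivots this is \<open>n - 2\<close> times the mean cost of the loop. Of the
  inner positions \<open>q - 2\<close> are read by \<open>k\<close> and \<open>n - q\<close> by
  \<open>g\<close>; of the other keys \<open>n - p - 1\<close> exceed \<open>p\<close>,
  \<open>q - 2\<close> are below \<open>q\<close> and \<open>n - q\<close> above. If
  \<open>q = n\<close>, no inner position carries the surcharge, and its term is zero as
  well.\<close>

lemma sum_scan_weights:
  fixes n :: nat and p q :: int
  assumes p: "1 \<le> p" "p < q" "q \<le> int n"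
  shows "(\<Sum>i\<in>{2..int n - 1}. \<Sum>x\<in>{1..int n} - {p, q}.
      1 + (if i < q then of_bool (p \<le> x) else of_bool (x \<le> q)) + 3 * of_bool (i = q \<and> q < x)) =
    (real n - 2)\<^sup>2 + (real_of_int q - 2) * (real n - real_of_int p - 1) + (real n - real_of_int q) * (real_of_int q - 2) + 3 * (real n - real_of_int q)"
proof -
  let ?J = "{2..int n - 1}" and ?X = "{1..int n} - {p, q}"
  have cardX: "card ?X = n - 2" using p by (simp add: card_Diff_subset)
  have inner: "(\<Sum>i\<in>?J. 1 + (if i < q then u else v) + 3 * (if i = q then w else 0)) =
      (real n - 2) + (real_of_int q - 2) * u + (real n - real_of_int q) * v + (if q = n then 0 else 3 * w)" for u v w :: real
  proof -
    have J: "?J = {2..<q} \<union> {q..int n - 1}" using p by auto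
    have "(\<Sum>i\<in>?J. if i < q then u else v) = (\<Sum>i\<in>{2..<q}. u) + (\<Sum>i\<in>{q..int n - 1}. v)"
      unfolding J by (subst sum.union_disjoint) auto
    also have "\<dots> = (real_of_int q - 2) * u + (real n - real_of_int q) * v" using p by simp
    finally have "(\<Sum>i\<in>?J. if i < q then u else v) = (real_of_int q - 2) * u + (real n - real_of_int q) * v" .
    moreover have "(\<Sum>i\<in>?J. 3 * (if i = q then w else 0)) = (if q = n then 0 else 3 * w)"
    proof -
      have "(\<Sum>i\<in>?J. 3 * (if i = q then w else 0)) = (\<Sum>i\<in>?J. if i = q then 3 * w else 0)"
        by (intro sum.cong) auto
      then show ?thesis using p by simp
    qed
    moreover have "(\<Sum>i\<in>?J. 1 :: real) = real n - 2" using p by simp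
    ultimately show ?thesis by (simp only: sum.distrib)
  qed
  have "(\<Sum>i\<in>?J. 1 + (if i < q then of_bool (p \<le> x) else of_bool (x \<le> q)) + 3 * of_bool (i = q \<and> q < x)) =
      (real n - 2) + (real_of_int q - 2) * of_bool (p \<le> x) + (real n - real_of_int q) * of_bool (x \<le> q) +
      (if q = n then 0 else 3 * of_bool (q < x))" for x
    unfolding inner[symmetric] by (intro sum.cong) auto
  then have "(\<Sum>i\<in>?J. \<Sum>x\<in>?X.
      1 + (if i < q then of_bool (p \<le> x) else of_bool (x \<le> q)) + 3 * of_bool (i = q \<and> q < x)) =
    (\<Sum>x\<in>?X. (real n - 2) + (real_of_int q - 2) * of_bool (p \<le> x) + (real n - real_of_int q) * of_bool (x \<le> q) +
      (if q = n then 0 else 3 * of_bool (q < x)))"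
    by (subst sum.swap) simp
  also have "\<dots> = (real n - 2)\<^sup>2 + (real_of_int q - 2) * (\<Sum>x\<in>?X. of_bool (p \<le> x)) + (real n - real_of_int q) * (\<Sum>x\<in>?X. of_bool (x \<le> q)) +
      (if q = n then 0 else 3 * (\<Sum>x\<in>?X. of_bool (q < x)))"
    using p by (simp add: sum.distrib sum_distrib_left cardX power2_eq_square)
  also have "(\<Sum>x\<in>?X. of_bool (p \<le> x)) = real n - real_of_int p - 1"
  proof -
    have "?X \<inter> {x. p \<le> x} = {p<..int n} - {q}" using p by auto
    then show ?thesis using p by (simp add: sum.If_cases of_bool_def card_Diff_subset)
  qed
  also have "(\<Sum>x\<in>?X. of_bool (x \<le> q)) = real_of_int q - 2"
  proof -
    have "?X \<inter> {x. x \<le> q} = {1..<q} - {p}" using p by auto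
    then show ?thesis using p by (simp add: sum.If_cases of_bool_def card_Diff_subset)
  qed
  also have "(\<Sum>x\<in>?X. of_bool (q < x)) = real n - real_of_int q"
  proof -
    have "?X \<inter> {x. q < x} = {q<..int n}" using p by auto
    then show ?thesis using p by (simp add: sum.If_cases of_bool_def)
  qed
  finally show ?thesis using p by auto
qed

text \<open>The range \<open>m\<close> is kept apart from the \<open>n\<close> in the weights to
  allow induction on \<open>m\<close>; it is used with \<open>m = n\<close>.\<close>

lemma sum_pairs_weights:
  fixes n m :: nat
  shows "(\<Sum>q\<in>{1..int m}. \<Sum>p\<in>{1..<q}.
      (real n - 2)\<^sup>2 + (real_of_int q - 2) * (real n - real_of_int p - 1) + (real n - real_of_int q) * (real_of_int q - 2) + 3 * (real n - real_of_int q)) =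
    real m * (real m - 1) * ((real n - 2)\<^sup>2 / 2 + (2 * real n - 1) * (real m - 2) / 3
      - 3 * (real m + 1) * (real m - 2) / 8 + 3 * real n / 2 - (real m + 1))"
proof -
  have inner: "(\<Sum>p\<in>{1..<int k + 1}. (real n - 2)\<^sup>2 + (real_of_int (int k + 1) - 2) * (real n - real_of_int p - 1) +
      (real n - real_of_int (int k + 1)) * (real_of_int (int k + 1) - 2) + 3 * (real n - real_of_int (int k + 1))) =
    real k * ((real n - 2)\<^sup>2 + (real k - 1) * (real n - 1) + (real n - real k - 1) * (real k - 1) +
      3 * (real n - real k - 1)) - (real k - 1) * (real k * (real k + 1) / 2)" (is "?l = _") for k
  proof -
    have set: "{1..<int k + 1} = {1..int k}" by auto
    have lin: "(\<Sum>i<j. x - y * (real i + 1)) = real j * x - y * (real j * (real j + 1) / 2)" for x y :: real and j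
      by (induction j) (simp_all add: field_simps)
    have "?l = (\<Sum>i<k. ((real n - 2)\<^sup>2 + (real k - 1) * (real n - 1) + (real n - real k - 1) * (real k - 1) +
      3 * (real n - real k - 1)) - (real k - 1) * (real i + 1))"
      unfolding set sum_int_interval by (intro sum.cong refl) (simp add: algebra_simps)
    then show ?thesis unfolding lin .
  qed
  show ?thesis unfolding sum_int_interval[of _ m] inner
    by (induction m) (simp_all add: field_simps power2_eq_square)
qed

text \<open>Exchanging inner positions replaces \<open>\<pi> i\<close> by an average over the keys
  other than the pivots, and the pivots form a uniform pair. The factor \<open>n - 2\<close> is
  cancelled at the end; for \<open>n = 2\<close> the loop does nothing and the formula is
  false.\<close>

lemma sum_permutes_partition_cost:
  assumes n: "n \<ge> 3"
  shows "(\<Sum>\<pi> | \<pi> permutes {1..int n}. real (partition_cost \<pi> (min (\<pi> 1) (\<pi> (int n))) (max (\<pi> 1) (\<pi> (int n)))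
    (max (\<pi> 1) (\<pi> (int n)) - 1) 2 (int n - 1))) = fact n * (19 / 12 * real n - 29 / 12)"
    (is "?lhs = _")
proof -
  let ?P = "{\<pi>. \<pi> permutes {1..int n}}" and ?J = "{2..int n - 1}"
  define w where "w i a b x = (1 + (if i < max a b then of_bool (min a b \<le> x) else of_bool (x \<le> max a b)) +
    3 * of_bool (i = max a b \<and> max a b < x) :: real)" for i a b x :: int
  define W where "W p q = (real n - 2)\<^sup>2 + (real_of_int q - 2) * (real n - real_of_int p - 1) + (real n - real_of_int q) * (real_of_int q - 2) + 3 * (real n - real_of_int q)"
    for p q :: int
  have J: "?J = {1..int n} - {1, int n}" by auto
  have cardJ: "card ?J = n - 2" using n by auto
  have ends: "\<pi> 1 \<in> {1..int n} \<and> \<pi> (int n) \<in> {1..int n} \<and> \<pi> 1 \<noteq> \<pi> (int n)" if "\<pi> \<in> ?P" for \<pi>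
  proof -
    from that have \<pi>: "\<pi> permutes {1..int n}" by simp
    show ?thesis
      using permutes_in_image[OF \<pi>, of 1] permutes_in_image[OF \<pi>, of "int n"]
        injD[OF permutes_inj[OF \<pi>], of 1 "int n"] n by auto
  qed
  have "?lhs = (\<Sum>\<pi>\<in>?P. \<Sum>i\<in>?J. w i (\<pi> 1) (\<pi> (int n)) (\<pi> i))"
  proof (rule sum.cong[OF refl], goal_cases)
    case (1 \<pi>)
    show ?case unfolding w_def using ends[OF 1] n by (intro sum_partition_cost) auto
  qed
  also have "\<dots> = (\<Sum>i\<in>?J. \<Sum>\<pi>\<in>?P. w i (\<pi> 1) (\<pi> (int n)) (\<pi> i))" by (rule sum.swap)
  finally have "real (card ?J) * ?lhs = (\<Sum>i\<in>?J. real (card ?J) * (\<Sum>\<pi>\<in>?P. w i (\<pi> 1) (\<pi> (int n)) (\<pi> i)))"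
    by (simp only: sum_distrib_left)
  also have "\<dots> = (\<Sum>i\<in>?J. \<Sum>\<pi>\<in>?P. \<Sum>x\<in>\<pi> ` ?J. w i (\<pi> 1) (\<pi> (int n)) x)"
    by (rule sum.cong[OF refl], rule sum_permutes_exchange) (auto simp: Transposition.transpose_def)
  also have "\<dots> = (\<Sum>\<pi>\<in>?P. \<Sum>i\<in>?J. \<Sum>x\<in>\<pi> ` ?J. w i (\<pi> 1) (\<pi> (int n)) x)" by (rule sum.swap)
  also have "\<dots> = (\<Sum>\<pi>\<in>?P. W (min (\<pi> 1) (\<pi> (int n))) (max (\<pi> 1) (\<pi> (int n))))"
  proof (rule sum.cong[OF refl])
    fix \<pi> assume \<pi>: "\<pi> \<in> ?P"
    then have "\<pi> ` ?J = {1..int n} - \<pi> ` {1, int n}"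
      unfolding J using n by (intro permutes_image_Diff) auto
    also have "\<pi> ` {1, int n} = {min (\<pi> 1) (\<pi> (int n)), max (\<pi> 1) (\<pi> (int n))}"
      by (auto simp: min_def max_def)
    finally have img: "\<pi> ` ?J = {1..int n} - {min (\<pi> 1) (\<pi> (int n)), max (\<pi> 1) (\<pi> (int n))}" .
    show "(\<Sum>i\<in>?J. \<Sum>x\<in>\<pi> ` ?J. w i (\<pi> 1) (\<pi> (int n)) x) =
      W (min (\<pi> 1) (\<pi> (int n))) (max (\<pi> 1) (\<pi> (int n)))"
      unfolding img w_def W_def by (rule sum_scan_weights) (use ends[OF \<pi>] in auto)
  qed
  finally have "real n * real (n - 1) * (real (n - 2) * ?lhs) =
      real n * real (n - 1) * (\<Sum>\<pi>\<in>?P. W (min (\<pi> 1) (\<pi> (int n))) (max (\<pi> 1) (\<pi> (int n))))"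
    unfolding cardJ by (simp only:)
  also have "\<dots> = fact n * (2 * (\<Sum>q\<in>{1..int n}. \<Sum>p\<in>{1..<q}. W p q))"
    using sum_permutes_endpoints[of n "\<lambda>a b. W (min a b) (max a b)"] sum_distinct_pairs[where n = n and S = W] n by simp
  also have "(\<Sum>q\<in>{1..int n}. \<Sum>p\<in>{1..<q}. W p q) = real n * (real n - 1) * (real n - 2) * (19 / 12 * real n - 29 / 12) / 2"
    unfolding W_def sum_pairs_weights by (simp add: field_simps power2_eq_square)
  finally have "(real n * (real n - 1) * (real n - 2)) * ?lhs =
      (real n * (real n - 1) * (real n - 2)) * (fact n * (19 / 12 * real n - 29 / 12))"
    using n by (simp add: of_nat_diff)
  moreover have nz: "real n * (real n - 1) * (real n - 2) \<noteq> 0" using n by auto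
  ultimately show ?thesis unfolding mult_left_cancel[OF nz] by simp
qed

section \<open>The recurrence for the expectation\<close>

lemma sum_block_expectation:
  fixes s :: "int \<Rightarrow> int \<Rightarrow> int" and m :: "int \<Rightarrow> int \<Rightarrow> nat"
  defines "p \<equiv> \<lambda>\<pi> :: int \<Rightarrow> int. \<lambda>n :: nat. min (\<pi> 1) (\<pi> (int n))"
    and "q \<equiv> \<lambda>\<pi> :: int \<Rightarrow> int. \<lambda>n :: nat. max (\<pi> 1) (\<pi> (int n))"
  assumes "n \<ge> 2"
    and sm: "\<And>p q. 1 \<le> p \<Longrightarrow> p < q \<Longrightarrow> q \<le> int n \<Longrightarrow> s p q = 0 \<and> int (m p q) = p - 1 \<or>
      s p q = p \<and> int (m p q) = q - p - 1 \<or> s p q = q \<and> int (m p q) = int n - q"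
  shows "(\<Sum>\<pi> | \<pi> permutes {1..int n}. real (key_comparisons M (m (p \<pi> n) (q \<pi> n))
      (block (fst (partition_step \<pi> 1 (int n))) (s (p \<pi> n) (q \<pi> n)) (m (p \<pi> n) (q \<pi> n))))) =
    (\<Sum>\<pi> | \<pi> permutes {1..int n}. expected_comparisons M (m (p \<pi> n) (q \<pi> n)))"
proof (rule sum_permutes_fibres)
  show "1 \<le> n" using \<open>n \<ge> 2\<close> by simp
  fix a b
  let ?X = "{\<pi>. \<pi> permutes {1..int n} \<and> \<pi> 1 = a \<and> \<pi> (int n) = b}"
  let ?s = "s (min a b) (max a b)" and ?m = "m (min a b) (max a b)"
  have "(\<Sum>\<pi>\<in>?X. real (key_comparisons M ?m (block (fst (partition_step \<pi> 1 (int n))) ?s ?m))) =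
      (\<Sum>\<pi>\<in>?X. expected_comparisons M ?m)"
  proof (cases "?X = {}")
    case False
    then obtain \<pi> where \<pi>: "\<pi> permutes {1..int n}" "\<pi> 1 = a" "\<pi> (int n) = b" by blast
    have "a \<noteq> b" using injD[OF permutes_inj[OF \<pi>(1)], of 1 "int n"] \<pi>(2,3) \<open>n \<ge> 2\<close> by auto
    then have "1 \<le> min a b" "min a b < max a b" "max a b \<le> int n"
      using permutes_in_image[OF \<pi>(1), of 1] permutes_in_image[OF \<pi>(1), of "int n"] \<pi>(2,3) \<open>n \<ge> 2\<close>
      by auto
    from sum_block_average[OF \<open>n \<ge> 2\<close> sm[OF this], of "\<lambda>\<tau>. real (key_comparisons M ?m \<tau>)"]
    show ?thesis by (simp only: expected_comparisons_eq)
  next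
    case True
    then show ?thesis by (simp only: sum.empty)
  qed
  then show "(\<Sum>\<pi>\<in>?X. real (key_comparisons M (m (p \<pi> n) (q \<pi> n))
      (block (fst (partition_step \<pi> 1 (int n))) (s (p \<pi> n) (q \<pi> n)) (m (p \<pi> n) (q \<pi> n))))) =
    (\<Sum>\<pi>\<in>?X. expected_comparisons M (m (p \<pi> n) (q \<pi> n)))"
    by (simp add: p_def q_def)
qed

text \<open>The right subarray has length \<open>n - q\<close> for each of the \<open>q - 1\<close>
  choices of \<open>p\<close>. Both sides give \<open>f k\<close> the weight
  \<open>n - 1 - k\<close>, so it contributes the same double sum as the other two
  subarrays.\<close>

lemma sum_linear_weights:
  fixes f :: "nat \<Rightarrow> real"
  shows "(\<Sum>j<n. real j * f (n - Suc j)) = (\<Sum>j<n. \<Sum>k<j. f k)"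
proof -
  have "(\<Sum>j<n. real j * f (n - Suc j)) = (\<Sum>j<n. real (n - Suc j) * f j)"
    using sum.nat_diff_reindex[of "\<lambda>j. real (n - Suc j) * f j" n] by (auto intro!: sum.cong)
  also have "\<dots> = (\<Sum>j<n. \<Sum>k<j. f k)"
  proof (induction n)
    case (Suc n)
    have "(\<Sum>j<n. real (Suc n - Suc j) * f j) = (\<Sum>j<n. real (n - Suc j) * f j + f j)"
      by (intro sum.cong refl) (auto simp: Suc_diff_Suc[symmetric] algebra_simps)
    then show ?case using Suc by (simp add: sum.distrib)
  qed simp
  finally show ?thesis .
qed

text \<open>The partitioning cost stays unevaluated, so that \<open>n = 2\<close> is covered too.
  The 6 counts three subarrays and two orders of the pivots.\<close>

lemma expected_comparisons_partition:
  fixes n M :: nat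
  defines "p \<equiv> \<lambda>\<pi> :: int \<Rightarrow> int. min (\<pi> 1) (\<pi> (int n))"
    and "q \<equiv> \<lambda>\<pi> :: int \<Rightarrow> int. max (\<pi> 1) (\<pi> (int n))"
  assumes "M \<ge> 1" "n > M"
  shows "fact n * expected_comparisons M n = fact n +
    (\<Sum>\<pi> | \<pi> permutes {1..int n}. real (partition_cost \<pi> (p \<pi>) (q \<pi>) (q \<pi> - 1) 2 (int n - 1))) +
    fact n * (6 / (real n * (real n - 1)) * (\<Sum>j<n. \<Sum>k<j. expected_comparisons M k))"
proof -
  let ?P = "{\<pi>. \<pi> permutes {1..int n}}"
  have n: "n \<ge> 2" using assms by simp
  define E where "E = expected_comparisons M"
  define part where "part \<pi> = fst (partition_step \<pi> 1 (int n))" for \<pi> :: "int \<Rightarrow> int"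
  have pointwise: "real (key_comparisons M n \<pi>) = 1 + real (partition_cost \<pi> (p \<pi>) (q \<pi>) (q \<pi> - 1) 2 (int n - 1)) +
      (real (key_comparisons M (nat (p \<pi> - 1)) (block (part \<pi>) 0 (nat (p \<pi> - 1)))) +
       real (key_comparisons M (nat (q \<pi> - p \<pi> - 1)) (block (part \<pi>) (p \<pi>) (nat (q \<pi> - p \<pi> - 1)))) +
       real (key_comparisons M (nat (int n - q \<pi>)) (block (part \<pi>) (q \<pi>) (nat (int n - q \<pi>)))))"
    if "\<pi> \<in> ?P" for \<pi>
  proof -
    have \<pi>: "\<pi> permutes {1..int n}" using that by simp
    from partition_step_permutation[OF \<pi> n] obtain A where
      A: "partition_step \<pi> 1 (int n) = (A, p \<pi>, q \<pi>, 1 + partition_cost \<pi> (p \<pi>) (q \<pi>) (q \<pi> - 1) 2 (int n - 1))"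
      "inj_on A {1..int n}" "1 \<le> p \<pi>" "p \<pi> < q \<pi>" "q \<pi> \<le> int n"
      unfolding p_def q_def by metis
    have inj: "inj_on A {k + 1..k + int j}" if "0 \<le> k" "k + int j \<le> int n" for k j
      by (rule inj_on_subset[OF A(2)]) (use that in auto)
    have "key_comparisons M n \<pi> = 1 + partition_cost \<pi> (p \<pi>) (q \<pi>) (q \<pi> - 1) 2 (int n - 1) +
      snd (quicksort M A 1 (p \<pi> - 1)) + snd (quicksort M A (p \<pi> + 1) (q \<pi> - 1)) +
      snd (quicksort M A (q \<pi> + 1) (int n))"
      unfolding key_comparisons_def
      by (rule quicksort_count_rec[OF \<open>M \<ge> 1\<close> _ permutes_inj_on[OF \<pi>] A(1)]) (use assms in simp)
    moreover have "snd (quicksort M A 1 (p \<pi> - 1)) = key_comparisons M (nat (p \<pi> - 1)) (block A 0 (nat (p \<pi> - 1)))"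
      using quicksort_block[OF \<open>M \<ge> 1\<close> inj, of 0 "nat (p \<pi> - 1)"] A(3-5) by simp
    moreover have "snd (quicksort M A (p \<pi> + 1) (q \<pi> - 1)) =
        key_comparisons M (nat (q \<pi> - p \<pi> - 1)) (block A (p \<pi>) (nat (q \<pi> - p \<pi> - 1)))"
      using quicksort_block[OF \<open>M \<ge> 1\<close> inj, of "p \<pi>" "nat (q \<pi> - p \<pi> - 1)"] A(3-5) by simp
    moreover have "snd (quicksort M A (q \<pi> + 1) (int n)) =
        key_comparisons M (nat (int n - q \<pi>)) (block A (q \<pi>) (nat (int n - q \<pi>)))"
      using quicksort_block[OF \<open>M \<ge> 1\<close> inj, of "q \<pi>" "nat (int n - q \<pi>)"] A(3-5) by simp
    moreover have "part \<pi> = A" using A(1) by (simp add: part_def)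
    ultimately show ?thesis by simp
  qed
  have blocks: "(\<Sum>\<pi>\<in>?P. real (key_comparisons M (nat (p \<pi> - 1)) (block (part \<pi>) 0 (nat (p \<pi> - 1))))) =
      (\<Sum>\<pi>\<in>?P. E (nat (p \<pi> - 1)))"
    "(\<Sum>\<pi>\<in>?P. real (key_comparisons M (nat (q \<pi> - p \<pi> - 1)) (block (part \<pi>) (p \<pi>) (nat (q \<pi> - p \<pi> - 1))))) =
      (\<Sum>\<pi>\<in>?P. E (nat (q \<pi> - p \<pi> - 1)))"
    "(\<Sum>\<pi>\<in>?P. real (key_comparisons M (nat (int n - q \<pi>)) (block (part \<pi>) (q \<pi>) (nat (int n - q \<pi>))))) =
      (\<Sum>\<pi>\<in>?P. E (nat (int n - q \<pi>)))"
    unfolding p_def q_def part_def E_def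
    using sum_block_expectation[OF n, of "\<lambda>p q. 0" "\<lambda>p q. nat (p - 1)" M]
      sum_block_expectation[OF n, of "\<lambda>p q. p" "\<lambda>p q. nat (q - p - 1)" M]
      sum_block_expectation[OF n, of "\<lambda>p q. q" "\<lambda>p q. nat (int n - q)" M]
    by simp_all
  define e where "e p q = E (nat (p - 1)) + E (nat (q - p - 1)) + E (nat (int n - q))" for p q :: int
  have "fact n * E n = (\<Sum>\<pi>\<in>?P. real (key_comparisons M n \<pi>))"
    by (simp add: E_def expected_comparisons_eq)
  also have "\<dots> = fact n + (\<Sum>\<pi>\<in>?P. real (partition_cost \<pi> (p \<pi>) (q \<pi>) (q \<pi> - 1) 2 (int n - 1))) + (\<Sum>\<pi>\<in>?P. e (p \<pi>) (q \<pi>))"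
    using pointwise blocks by (simp add: sum.distrib e_def card_permutes_int)
  also have "(\<Sum>\<pi>\<in>?P. e (p \<pi>) (q \<pi>)) = fact n * (6 / (real n * (real n - 1)) * (\<Sum>j<n. \<Sum>k<j. E k))"
  proof -
    have "real n * (real n - 1) * (\<Sum>\<pi>\<in>?P. e (p \<pi>) (q \<pi>)) =
        fact n * (2 * (\<Sum>q\<in>{1..int n}. \<Sum>p\<in>{1..<q}. e p q))"
      using sum_permutes_endpoints[OF n, of "\<lambda>a b. e (min a b) (max a b)"]
        sum_distinct_pairs[where n = n and S = e] n
      by (simp add: p_def q_def of_nat_diff)
    also have "(\<Sum>q\<in>{1..int n}. \<Sum>p\<in>{1..<q}. e p q) = (\<Sum>j<n. 2 * (\<Sum>k<j. E k) + real j * E (n - Suc j))"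
      unfolding sum_int_interval
    proof (rule sum.cong[OF refl])
      fix j assume j: "j \<in> {..<n}"
      have set: "{1..<int j + 1} = {1..int j}" by auto
      have "(\<Sum>p\<in>{1..<int j + 1}. e p (int j + 1)) = (\<Sum>i<j. E i + E (j - Suc i) + E (n - Suc j))"
        unfolding set sum_int_interval e_def
        by (intro sum.cong refl arg_cong2[of _ _ _ _ "(+)"] arg_cong[of _ _ E]) auto
      also have "\<dots> = 2 * (\<Sum>k<j. E k) + real j * E (n - Suc j)"
        using sum.nat_diff_reindex[of E j] by (simp add: sum.distrib)
      finally show "(\<Sum>p\<in>{1..<int j + 1}. e p (int j + 1)) = 2 * (\<Sum>k<j. E k) + real j * E (n - Suc j)" .
    qed
    also have "\<dots> = 3 * (\<Sum>j<n. \<Sum>k<j. E k)"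
      by (simp add: sum.distrib sum_linear_weights sum_distrib_left[symmetric])
    finally have "real n * (real n - 1) * (\<Sum>\<pi>\<in>?P. e (p \<pi>) (q \<pi>)) = fact n * (6 * (\<Sum>j<n. \<Sum>k<j. E k))" by simp
    moreover have "real n * (real n - 1) \<noteq> 0" using n by auto
    ultimately show ?thesis by (simp add: field_simps)
  qed
  finally show ?thesis by (simp add: E_def)
qed

lemma expected_comparisons_rec:
  assumes "M \<ge> 1" "n > M" "n \<ge> 3"
  shows "expected_comparisons M n = 19 / 12 * (real n + 1) - 3 +
    6 / (real n * (real n - 1)) * (\<Sum>j<n. \<Sum>k<j. expected_comparisons M k)"
proof -
  have "fact n * expected_comparisons M n = fact n * (19 / 12 * (real n + 1) - 3 +
    6 / (real n * (real n - 1)) * (\<Sum>j<n. \<Sum>k<j. expected_comparisons M k))"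
    unfolding expected_comparisons_partition[OF assms(1,2)] sum_permutes_partition_cost[OF assms(3)]
    by (simp add: algebra_simps)
  then show ?thesis by simp
qed

text \<open>With no inner positions only the comparison of the two ends remains.\<close>

lemma expected_comparisons_two: "expected_comparisons 1 2 = 1"
proof -
  have "expected_comparisons 1 0 = 0" using expected_insertion[of 0 1] by (simp add: harm_expand)
  moreover have "partition_cost \<pi> p q (q - 1) 2 (int 2 - 1) = 0" for \<pi> :: "int \<Rightarrow> int" and p q
    by (auto simp: partition_cost_def)
  ultimately show ?thesis
    using expected_comparisons_partition[of 1 2] by (simp add: numeral_2_eq_2)
qed

subsection \<open>Solving the recurrence\<close>

text \<open>After multiplication by \<open>n * (n - 1)\<close> the history is a double partial sum,
  whose second difference is the single value \<open>E n\<close>. The last coefficient is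
  \<open>n * (n - 1) - 6 = (n - 3) * (n + 2)\<close>.\<close>

lemma expected_comparisons_diff_eq:
  fixes M n :: nat
  defines "E \<equiv> expected_comparisons M"
  assumes "M \<ge> 1" "n > M" "n \<ge> 3"
  shows "(real n + 2) * (real n + 1) * E (n + 2) - 2 * (real n + 1) * real n * E (n + 1) +
    (real n - 3) * (real n + 2) * E n = 19 / 2 * (real n + 1) - 6"
proof -
  define W where "W m = (\<Sum>j<m. \<Sum>k<j. E k)" for m
  define T where "T m = 19 / 12 * (m + 1) - 3" for m :: real
  have rec: "real k * (real k - 1) * E k = real k * (real k - 1) * T k + 6 * W k" if "k \<ge> n" for k
    using expected_comparisons_rec[OF assms(2), of k] that assms(3,4)
    by (simp add: E_def W_def T_def field_simps)
  have "W (n + 2) - 2 * W (n + 1) + W n = E n" by (simp add: W_def)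
  moreover have "real (n + 2) * (real (n + 2) - 1) * E (n + 2) - 2 * (real (n + 1) * (real (n + 1) - 1) * E (n + 1))
      + real n * (real n - 1) * E n = real (n + 2) * (real (n + 2) - 1) * T (real (n + 2))
      - 2 * (real (n + 1) * (real (n + 1) - 1) * T (real (n + 1))) + real n * (real n - 1) * T n
      + 6 * (W (n + 2) - 2 * W (n + 1) + W n)"
    by (simp only: rec) (simp add: rec)
  ultimately show ?thesis by (simp add: T_def field_simps)
qed

text \<open>The operator sends \<open>(n + 1) * harm (n + 1)\<close> to \<open>5 * (n + 1)\<close>,
  the constant 1 to \<open>-4\<close> and \<open>n + 1\<close> to 0. This gives \<open>19/10\<close>
  and \<open>3/2\<close> and leaves \<open>a\<close> and \<open>K\<close> free.\<close>

lemma candidate_diff_eq: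
  fixes a K :: real and n :: nat
  defines "G \<equiv> \<lambda>n :: nat. 19 / 10 * (real n + 1) * (harm (n + 1) - a) + K * (real n + 1) + 3 / 2"
  shows "(real n + 2) * (real n + 1) * G (n + 2) - 2 * (real n + 1) * real n * G (n + 1) +
    (real n - 3) * (real n + 2) * G n = 19 / 2 * (real n + 1) - 6"
proof -
  define x where "x = real n"
  define h where "h = (harm (n + 1) :: real)"
  have h: "(harm (Suc (Suc (Suc n))) :: real) = h + 1 / (x + 2) + 1 / (x + 3)"
    "(harm (Suc (Suc n)) :: real) = h + 1 / (x + 2)" "(harm (Suc n) :: real) = h"
    by (simp_all add: h_def harm_Suc x_def field_simps)
  have "x \<ge> 0" by (simp add: x_def)
  show ?thesis
    unfolding G_def using \<open>x \<ge> 0\<close> by (simp add: h x_def[symmetric]) (simp add: divide_simps, algebra)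
qed

text \<open>The factor \<open>e (n + 1) - (n - 3) / (n + 1) * e n\<close> vanishes on the decaying solution
  \<open>1 / (n * (n - 1) * (n - 2) * (n - 3))\<close> and equals \<open>5\<close> times the coefficient of the other
  solution \<open>n + 1\<close>, so one value of it decides whether the growing solution is present.\<close>

lemma homogeneous_no_growth:
  fixes e :: "nat \<Rightarrow> real"
  assumes hom: "\<And>n. n \<ge> N \<Longrightarrow> (real n + 2) * (real n + 1) * e (n + 2) -
      2 * (real n + 1) * real n * e (n + 1) + (real n - 3) * (real n + 2) * e n = 0"
    and start: "(real N + 1) * e (N + 1) = (real N - 3) * e N" and "n \<ge> N"
  shows "(real n + 1) * e (n + 1) = (real n - 3) * e n"
  using \<open>n \<ge> N\<close>
proof (induction n rule: dec_induct)
  case (step n)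
  \<comment> \<open>The operator factors: with
    \<open>D n = (n + 1) * e (n + 1) - (n - 3) * e n\<close> it is
    \<open>(n + 1) * D (n + 1) - (n + 2) * D n\<close>, so a zero of \<open>D\<close>
    propagates.\<close>
  have "(real n + 1) * ((real n + 2) * e (n + 2) - (real n - 2) * e (n + 1)) =
      (real n + 2) * ((real n + 1) * e (n + 1) - (real n - 3) * e n)"
    using hom[OF step.hyps(1)] by (simp add: algebra_simps)
  also have "\<dots> = 0" using step.IH by simp
  finally have "(real n + 2) * e (n + 2) - (real n - 2) * e (n + 1) = 0"
    by (simp add: add_nonneg_eq_0_iff)
  then show ?case by (simp add: algebra_simps)
qed (rule start)

lemma no_growth_bigo:
  fixes e :: "nat \<Rightarrow> real"
  assumes "\<And>n. n \<ge> N \<Longrightarrow> (real n + 1) * e (n + 1) = (real n - 3) * e n"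
  shows "e \<in> O(\<lambda>n. 1 / real n ^ 4)"
proof -
  define F where "F n = real n * (real n - 1) * (real n - 2) * (real n - 3) * e n" for n
  have F: "F n = F N" if "n \<ge> N" for n
    using that
  proof (induction n rule: dec_induct)
    case (step n)
    have "F (Suc n) = real n * (real n - 1) * (real n - 2) * ((real n + 1) * e (n + 1))"
      by (simp add: F_def algebra_simps)
    also have "\<dots> = F n" unfolding assms[OF step.hyps(1)] by (simp add: F_def)
    finally show ?case using step.IH by simp
  qed simp
  have "norm (e n) \<le> 16 * \<bar>F N\<bar> * norm (1 / real n ^ 4)" if n: "n \<ge> max N 4" for n
  proof -
    define x where "x = real n"
    have x: "x \<ge> 4" using n by (simp add: x_def)
    \<comment> \<open>For \<open>x \<ge> 4\<close> both \<open>x - 1\<close> and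
      \<open>x - 2\<close> are at least \<open>x / 2\<close>, and \<open>x - 3\<close> is at least
      \<open>x / 4\<close>; thus 16 is \<open>2 * 2 * 4\<close>.\<close>
    have "x ^ 4 = 16 * (x * (x / 2) * (x / 2) * (x / 4))" by (simp add: power4_eq_xxxx)
    also have "\<dots> \<le> 16 * (x * (x - 1) * (x - 2) * (x - 3))"
      using x by (intro mult_mono order_refl) auto
    finally have "x ^ 4 * \<bar>e n\<bar> \<le> 16 * (x * (x - 1) * (x - 2) * (x - 3)) * \<bar>e n\<bar>"
      by (intro mult_right_mono) auto
    also have "\<dots> = 16 * \<bar>F n\<bar>" using x by (simp add: F_def x_def abs_mult)
    finally have "x ^ 4 * \<bar>e n\<bar> \<le> 16 * \<bar>F N\<bar>" using F[of n] n by simp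
    then show ?thesis using x by (simp add: x_def field_simps)
  qed
  then show ?thesis by (intro bigoI[of _ "16 * \<bar>F N\<bar>"] eventually_sequentiallyI)
qed

section \<open>Values just above the threshold\<close>

lemma sum_insertion_costs:
  fixes m :: nat
  shows "(\<Sum>k<m. real k * (real k - 1) / 4 + real k - harm k) =
    real m * (real m - 1) * (real m - 2) / 12 + real m * (real m - 1) / 2 + real m - real m * harm m"
    and "(\<Sum>j<m. \<Sum>k<j. real k * (real k - 1) / 4 + real k - harm k) =
      real m * (real m - 1) * (real m - 2) * (real m - 3) / 48 + real m * (real m - 1) * (real m - 2) / 6 +
      3 * real m * (real m - 1) / 4 - real m * (real m - 1) / 2 * harm m"
proof -
  have inv: "real (Suc m) * harm (Suc m) = real (Suc m) * harm m + (1 :: real)" for m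
    by (simp add: harm_Suc field_simps)
  show 1: "(\<Sum>k<m. real k * (real k - 1) / 4 + real k - harm k) =
    real m * (real m - 1) * (real m - 2) / 12 + real m * (real m - 1) / 2 + real m - real m * harm m" for m
  proof (induction m)
    case (Suc m)
    show ?case unfolding sum.lessThan_Suc Suc inv by (simp add: field_simps)
  qed simp
  have inv': "real (Suc m) * (real (Suc m) - 1) / 2 * harm (Suc m) =
      real m / 2 * (real (Suc m) * harm m + (1 :: real))" for m
    unfolding inv[symmetric] by simp
  show "(\<Sum>j<m. \<Sum>k<j. real k * (real k - 1) / 4 + real k - harm k) =
      real m * (real m - 1) * (real m - 2) * (real m - 3) / 48 + real m * (real m - 1) * (real m - 2) / 6 +
      3 * real m * (real m - 1) / 4 - real m * (real m - 1) / 2 * harm m"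
  proof (induction m)
    case (Suc m)
    show ?case by (subst sum.lessThan_Suc, subst Suc.IH, subst 1, subst inv') (simp add: field_simps)
  qed simp
qed

text \<open>The first-order relation at \<open>n = M + 1\<close>. It is a linear equation for the
  coefficient of \<open>n + 1\<close> in \<open>G\<close>, and the coefficient in the theorem is its
  solution.\<close>

lemma expected_comparisons_start:
  fixes M :: nat
  defines "E \<equiv> expected_comparisons M"
    and "G \<equiv> \<lambda>n. 19 / 10 * (real n + 1) * (harm (n + 1) - harm (M + 2))
             + (124 / 75 + 3 / 20 * real M - 9 / (5 * (real M + 2))
                - 12 / (5 * (real M + 2)) * harm (M + 1)) * (real n + 1)
             + 3 / 2"
  assumes "M \<ge> 2"
  shows "(real M + 2) * (E (M + 2) - G (M + 2)) = (real M - 2) * (E (M + 1) - G (M + 1))"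
proof -
  define x where "x = real M"
  define h where "h = (harm (M + 1) :: real)"
  have x: "x \<ge> 2" using assms by (simp add: x_def)
  have h: "(harm (M + 1) :: real) = h" "(harm (M + 2) :: real) = h + 1 / (x + 2)"
    "(harm (M + 3) :: real) = h + 1 / (x + 2) + 1 / (x + 3)"
    by (simp_all add: h_def harm_Suc x_def field_simps numeral_2_eq_2 numeral_3_eq_3)
  \<comment> \<open>Two pivots drop out of each partitioning step, so even for size
    \<open>M + 2\<close> only sizes up to \<open>M\<close> occur, all handled by insertion
    sort.\<close>
  have W: "(\<Sum>j<m. \<Sum>k<j. E k) =
      real m * (real m - 1) * (real m - 2) * (real m - 3) / 48 + real m * (real m - 1) * (real m - 2) / 6 +
      3 * real m * (real m - 1) / 4 - real m * (real m - 1) / 2 * harm m" if "m \<le> M + 2" for m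
    unfolding sum_insertion_costs(2)[symmetric] E_def
    by (intro sum.cong refl expected_insertion) (use that in auto)
  have W1: "M + 1 \<le> M + 2" by simp
  have rx: "real (M + 1) = x + 1" "real (M + 2) = x + 2" by (simp_all add: x_def)
  have "E (M + 1) = 19 / 12 * (x + 1 + 1) - 3 + 6 / ((x + 1) * (x + 1 - 1)) *
      ((x + 1) * (x + 1 - 1) * (x + 1 - 2) * (x + 1 - 3) / 48 + (x + 1) * (x + 1 - 1) * (x + 1 - 2) / 6 +
      3 * (x + 1) * (x + 1 - 1) / 4 - (x + 1) * (x + 1 - 1) / 2 * h)"
    using expected_comparisons_rec[of M "M + 1", folded E_def] assms(3)
    unfolding W[OF W1] rx h by simp
  also have "\<dots> = 19 / 12 * (x + 2) - 3 + ((x - 1) * (x - 2) / 8 + (x - 1) + 9 / 2 - 3 * h)"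
    using x by (simp add: divide_simps, algebra)
  finally have E1: "E (M + 1) = 19 / 12 * (x + 2) - 3 + ((x - 1) * (x - 2) / 8 + (x - 1) + 9 / 2 - 3 * h)" .
  have "E (M + 2) = 19 / 12 * (x + 2 + 1) - 3 + 6 / ((x + 2) * (x + 2 - 1)) *
      ((x + 2) * (x + 2 - 1) * (x + 2 - 2) * (x + 2 - 3) / 48 + (x + 2) * (x + 2 - 1) * (x + 2 - 2) / 6 +
      3 * (x + 2) * (x + 2 - 1) / 4 - (x + 2) * (x + 2 - 1) / 2 * (h + 1 / (x + 2)))"
    using expected_comparisons_rec[of M "M + 2", folded E_def] assms(3)
    unfolding W[OF order_refl] rx h by simp
  also have "\<dots> = 19 / 12 * (x + 3) - 3 + (x * (x - 1) / 8 + x + 9 / 2 - 3 * (h + 1 / (x + 2)))"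
    using x by (simp add: divide_simps, algebra)
  finally have E2: "E (M + 2) = 19 / 12 * (x + 3) - 3 + (x * (x - 1) / 8 + x + 9 / 2 - 3 * (h + 1 / (x + 2)))" .
  \<comment> \<open>The offset \<open>harm (M + 2)\<close> makes the harmonic part vanish at
    \<open>M + 1\<close> and equal \<open>19/10\<close> at \<open>M + 2\<close>.\<close>
  have G1: "G (M + 1) = (124 / 75 + 3 / 20 * x - 9 / (5 * (x + 2)) - 12 / (5 * (x + 2)) * h) * (x + 2) + 3 / 2"
    by (simp add: G_def h x_def) (simp add: h_def)
  have G2: "G (M + 2) = 19 / 10 + (124 / 75 + 3 / 20 * x - 9 / (5 * (x + 2)) - 12 / (5 * (x + 2)) * h) * (x + 3) + 3 / 2"
  proof -
    have "(harm (M + 2 + 1) :: real) - harm (M + 2) = 1 / (x + 3)" "real (M + 2) + 1 = x + 3"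
      using h by (simp_all add: x_def numeral_eq_Suc)
    then have "G (M + 2) = 19 / 10 * (x + 3) * (1 / (x + 3)) +
        (124 / 75 + 3 / 20 * x - 9 / (5 * (x + 2)) - 12 / (5 * (x + 2)) * h) * (x + 3) + 3 / 2"
      by (simp only: G_def h(1) x_def)
    moreover have "(x + 3) * (1 / (x + 3)) = 1" using x by simp
    ultimately show ?thesis by (simp only: mult.assoc mult_1_right)
  qed
  show ?thesis unfolding E1 E2 G1 G2 x_def[symmetric] using x by (simp add: divide_simps, algebra)
qed

theorem theorem3p8:
  fixes M :: nat
  assumes "M \<ge> 1"
  shows
    "(M \<ge> 2 \<longrightarrow>
       (\<lambda>n. expected_comparisons M n
          - (19 / 10 * (real n + 1) * (harm (n + 1) - harm (M + 2))
             + (124 / 75 + 3 / 20 * real M - 9 / (5 * (real M + 2))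
                - 12 / (5 * (real M + 2)) * harm (M + 1)) * (real n + 1)
             + 3 / 2)) \<in> O(\<lambda>n. 1 / real n ^ 4))
     \<and> (M = 1 \<longrightarrow>
       (\<forall>n\<ge>4. expected_comparisons M n
          = 19 / 10 * (real n + 1) * harm n - 711 / 200 * real n - 31 / 200))"
proof (intro conjI impI allI)
  assume M: "M \<ge> 2"
  define E where "E = expected_comparisons M"
  define K where "K = 124 / 75 + 3 / 20 * real M - 9 / (5 * (real M + 2))
    - 12 / (5 * (real M + 2)) * harm (M + 1)"
  define G where "G n = 19 / 10 * (real n + 1) * (harm (n + 1) - harm (M + 2)) + K * (real n + 1) + 3 / 2" for n
  have "(real n + 2) * (real n + 1) * (E (n + 2) - G (n + 2)) -
      2 * (real n + 1) * real n * (E (n + 1) - G (n + 1)) + (real n - 3) * (real n + 2) * (E n - G n) = 0"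
    if "n \<ge> M + 1" for n
    using expected_comparisons_diff_eq[OF assms, of n] candidate_diff_eq[of n "harm (M + 2)" K] that M
    by (simp add: E_def G_def right_diff_distrib)
  moreover have "(real (M + 1) + 1) * (E (M + 1 + 1) - G (M + 1 + 1)) = (real (M + 1) - 3) * (E (M + 1) - G (M + 1))"
  proof -
    have "M + 1 + 1 = M + 2" "real (M + 1) + 1 = real M + 2" "real (M + 1) - 3 = real M - 2" by simp_all
    then show ?thesis using expected_comparisons_start[OF M] by (simp only: E_def G_def K_def)
  qed
  ultimately have "(real n + 1) * (E (n + 1) - G (n + 1)) = (real n - 3) * (E n - G n)" if "n \<ge> M + 1" for n
    using homogeneous_no_growth[of "M + 1" "\<lambda>n. E n - G n" n] that by blast
  from no_growth_bigo[of "M + 1" "\<lambda>n. E n - G n", OF this]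
  show "(\<lambda>n. expected_comparisons M n
          - (19 / 10 * (real n + 1) * (harm (n + 1) - harm (M + 2))
             + (124 / 75 + 3 / 20 * real M - 9 / (5 * (real M + 2))
                - 12 / (5 * (real M + 2)) * harm (M + 1)) * (real n + 1)
             + 3 / 2)) \<in> O(\<lambda>n. 1 / real n ^ 4)"
    by (simp add: E_def G_def K_def)
next
  fix n :: nat
  assume M: "M = 1" and n: "n \<ge> 4"
  define E where "E = expected_comparisons 1"
  \<comment> \<open>With \<open>a = 0\<close> the coefficient \<open>-711/200\<close> is fixed by
    the value \<open>65/12\<close> at \<open>n = 4\<close>.\<close>
  define G where "G n = 19 / 10 * (real n + 1) * (harm (n + 1) - 0) + (- 711 / 200) * (real n + 1) + 3 / 2" for n
  have hom: "(real n + 2) * (real n + 1) * (E (n + 2) - G (n + 2)) -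
      2 * (real n + 1) * real n * (E (n + 1) - G (n + 1)) + (real n - 3) * (real n + 2) * (E n - G n) = 0"
    if "n \<ge> 3" for n
    using expected_comparisons_diff_eq[of 1 n] candidate_diff_eq[of n 0 "- 711 / 200"] that
    by (simp add: E_def G_def right_diff_distrib)
  have "E 0 = 0" "E 1 = 0" "E 2 = 1"
    using expected_insertion[of 0 1] expected_insertion[of 1 1] expected_comparisons_two
    by (simp_all add: E_def harm_expand)
  then have "E 4 = 19 / 12 * 5 - 3 + 1 / 2"
    using expected_comparisons_rec[of 1 4] by (simp add: E_def numeral_eq_Suc)
  moreover have "G 4 = 65 / 12" by (simp add: G_def harm_expand)
  ultimately have four: "E 4 - G 4 = 0" by simp
  \<comment> \<open>At \<open>n = 3\<close> the factor \<open>n - 3\<close> is zero, so the start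
    condition reads \<open>E 4 = G 4\<close> and leaves size 3 out, where the formula is
    false.\<close>
  have first_order: "(real n + 1) * (E (n + 1) - G (n + 1)) = (real n - 3) * (E n - G n)" if "n \<ge> 3" for n
    using homogeneous_no_growth[of 3 "\<lambda>n. E n - G n", OF hom _ that] four by simp
  have diff: "E n - G n = 0"
    using n
  proof (induction n rule: dec_induct)
    case (step n)
    then show ?case using first_order[of n] by (simp add: add_nonneg_eq_0_iff)
  qed (rule four)
  show "expected_comparisons M n = 19 / 10 * (real n + 1) * harm n - 711 / 200 * real n - 31 / 200"
  proof -
    \<comment> \<open>Passing from \<open>harm (n + 1)\<close> to \<open>harm n\<close> adds
      \<open>19/10\<close>, and \<open>19/10 - 711/200 + 3/2 = -31/200\<close>.\<close>
    have "(real n + 1) * harm (n + 1) = (real n + 1) * harm n + 1" by (simp add: harm_Suc field_simps)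
    moreover have "G n = 19 / 10 * ((real n + 1) * harm (n + 1)) - 711 / 200 * (real n + 1) + 3 / 2"
      by (simp add: G_def)
    ultimately have "G n = 19 / 10 * ((real n + 1) * harm n + 1) - 711 / 200 * (real n + 1) + 3 / 2" by simp
    also have "\<dots> = 19 / 10 * (real n + 1) * harm n - 711 / 200 * real n - 31 / 200" by (simp add: field_simps)
    finally show ?thesis using diff M by (simp add: E_def)
  qed
qed

end
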